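(* Suppose the law of $X$ satisfies the Assumption stated in the context (with associated function $x(\cdot)$). Let $\xi:=\limsup_{n\to\infty}x(n)/n\in[0,+\infty]$, let $\gamma>\rho_c/q+\xi$ (when $\xi<\infty$) and $\omega>0$, and set $$y(t):=\begin{cases}\gamma t&\text{if }\xi<\infty,\\(1+\omega)\,x((1+\omega)t)&\text{otherwise.}\end{cases}$$ Then $$\lim_{V\to\infty}\sup_{m\ge y(qV)}\left|\frac{\mathbb{P}\left(\sum_{i=1}^{N(qV)}X_i=m\right)}{qV\,\mathbb{P}\left(X=\lceil m-\rho_cV\rceil\right)}-1\right|=0.$$ Moreover, $$\lim_{V\to\infty}\sup_{m\ge y(qV)}\ \sup_{A\in\mathcal{B}(\cup_{n\ge1}(\mathbb{N}^* )^n)}\left|\mathbb{P}\left(\mathrm{bulk}(X_1,\dots,X_{N(qV)})\in A\,\Big|\,\sum_{i=1}^{N(qV)}X_i=m\right)-\mathbb{P}\left((X_1,\dots,X_{N(qV)-1})\in A\right)\right|=0.$$ Here $m$ ranges over integers.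
   Context: Notation: $\mathbb{N}^*=\{1,2,\dots\}$. $(Q_r)_{r\ge1}$ is a sequence of positive real numbers such that $\lim_{r\to\infty}Q_r^{1/r}$ exists in $(0,\infty)$; $\phi_c\in(0,\infty)$ is the reciprocal of this limit (the radius of convergence of $\sum_r rQ_r\phi^r$). Assumption. $q:=\sum_{r\ge1}Q_r\phi_c^r<\infty$ and $\rho_c:=\sum_{r\ge1}rQ_r\phi_c^r<\infty$. Let $X$ be an $\mathbb{N}^*$-valued random variable with $\mathbb{P}(X=k)=Q_k\phi_c^k/q$ (so $\rho_c=q\,\mathbb{E}X$) and $X_1,X_2,\dots$ i.i.d. copies of $X$. Then: (I) (subexponential density) $\lim_{m\to\infty}\frac{\mathbb{P}(X_1+X_2=m)}{2\mathbb{P}(X=m)}=1$; (II) there is a function $x:(0,\infty)\to(0,\infty)$, non-decreasing near infinity, such that $$\lim_{n\to\infty}\ \sup_{m\ge n\mathbb{E}X+x(n)}\left|\frac{\mathbb{P}(\sum_{i=1}^nX_i=m)}{n\,\mathbb{P}(X=\lceil m-n\mathbb{E}X\rceil)}-1\right|=0$$ ($n,m$ integers); (III) (intermediate regular variation) $$\lim_{\varepsilon\to0^+}\liminf_{m\to\infty}\inf_{|k/m-1|<\varepsilon}\frac{\mathbb{P}(X=k)}{\mathbb{P}(X=m)}=1,\qquad \lim_{\varepsilon\to0^+}\limsup_{m\to\infty}\sup_{|k/m-1|<\varepsilon}\frac{\mathbb{P}(X=k)}{\mathbb{P}(X=m)}=1$$ ($k,m\in\mathbb{N}^*$). $N(qV)$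 is a Poisson random variable with mean $qV$, independent of $(X_i)$. The map $\mathrm{bulk}$ deletes the first maximal entry of a finite sequence: $\mathrm{bulk}(x_1,\dots,x_n)=(x_1,\dots,x_{m^*-1},x_{m^*+1},\dots,x_n)$, where $m^*:=\inf\{i\ge1:x_i=\max_{1\le j\le n}x_j\}$ (the result is the empty sequence if $n=1$). $\mathcal{B}(\cup_{n\ge1}(\mathbb{N}^* )^n)$ is the family of all (Borel) subsets of the countable discrete set of nonempty finite sequences; on the event $N(qV)\le1$ the event $(X_1,\dots,X_{N(qV)-1})\in A$ is understood not to occur.
   Formalization: In the case ξ = ∞ it is assumed that x(n)/n tends to infinity, not merely that its limsup is infinite; with an oscillating x, y(t) can stay below t·E X for arbitrarily large t (e.g. Q_r = r^(-4)), and the claim fails. *)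

theory Defs
  imports "HOL-Probability.Probability"
begin

definition crit_fugacity :: "(nat \<Rightarrow> real) \<Rightarrow> real" where
  "crit_fugacity Q = inverse (lim (\<lambda>r. Q r powr (1 / real r)))"

text \<open>
  Only the values \<open>Q r\<close> with \<open>r \<ge> 1\<close> matter; series over \<open>r \<ge> 1\<close> are written with
  \<open>Suc r\<close>.
\<close>

definition weight_seq :: "(nat \<Rightarrow> real) \<Rightarrow> bool" where
  "weight_seq Q \<longleftrightarrow>
     (\<forall>r\<ge>1. Q r > 0) \<and> (\<exists>L>0. (\<lambda>r. Q r powr (1 / real r)) \<longlonglongrightarrow> L)"

definition crit_summable :: "(nat \<Rightarrow> real) \<Rightarrow> bool" where
  "crit_summable Q \<longleftrightarrow>
     summable (\<lambda>r. Q (Suc r) * crit_fugacity Q ^ Suc r) \<and>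
     summable (\<lambda>r. real (Suc r) * Q (Suc r) * crit_fugacity Q ^ Suc r)"

definition crit_q :: "(nat \<Rightarrow> real) \<Rightarrow> real" where
  "crit_q Q = (\<Sum>r. Q (Suc r) * crit_fugacity Q ^ Suc r)"

definition crit_rho :: "(nat \<Rightarrow> real) \<Rightarrow> real" where
  "crit_rho Q = (\<Sum>r. real (Suc r) * Q (Suc r) * crit_fugacity Q ^ Suc r)"

definition crit_law :: "'a measure \<Rightarrow> (nat \<Rightarrow> real) \<Rightarrow> ('a \<Rightarrow> nat) \<Rightarrow> bool" where
  "crit_law M Q X \<longleftrightarrow>
     X \<in> measurable M (count_space {1..}) \<and>
     (\<forall>k\<ge>1. \<P>(w in M. X w = k) = Q k * crit_fugacity Q ^ k / crit_q Q)"

definition iid_copies :: "'a measure \<Rightarrow> ('a \<Rightarrow> nat) \<Rightarrow> (nat \<Rightarrow> 'a \<Rightarrow> nat) \<Rightarrow> bool" where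
  "iid_copies M X Xs \<longleftrightarrow>
     prob_space.indep_vars M (\<lambda>_. count_space {1..}) Xs {1..} \<and>
     (\<forall>i\<ge>1. distr M (count_space {1..}) (Xs i) = distr M (count_space {1..}) X)"

text \<open>
  Independence is stated between generated sigma-algebras because \<open>indep_var\<close> needs both
  variables to have the same type. For different means \<open>t\<close> no relation between the variables
  \<open>N t\<close> is assumed.
\<close>

definition indep_poisson ::
  "'a measure \<Rightarrow> (nat \<Rightarrow> 'a \<Rightarrow> nat) \<Rightarrow> real \<Rightarrow> ('a \<Rightarrow> nat) \<Rightarrow> bool" where
  "indep_poisson M Xs t N \<longleftrightarrow>
     N \<in> measurable M (count_space UNIV) \<and>
     distr M (count_space UNIV) N = measure_pmf (poisson_pmf t) \<and>
     prob_space.indep_set M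
       (sets (vimage_algebra (space M) N (count_space UNIV)))
       (sets (vimage_algebra (space M) (\<lambda>w. \<lambda>i\<in>{1..}. Xs i w)
                (PiM {1..} (\<lambda>_. count_space {1..}))))"

definition subexp_density ::
  "'a measure \<Rightarrow> ('a \<Rightarrow> nat) \<Rightarrow> (nat \<Rightarrow> 'a \<Rightarrow> nat) \<Rightarrow> bool" where
  "subexp_density M X Xs \<longleftrightarrow>
     (\<lambda>m. \<P>(w in M. Xs 1 w + Xs 2 w = m) / (2 * \<P>(w in M. X w = m))) \<longlonglongrightarrow> 1"

text \<open>
  Suprema and infima are taken in \<^typ>\<open>ereal\<close>, where they always exist; a real-valued supremum
  over an unbounded set would be an unspecified number.
\<close>

definition one_big_jump ::
  "'a measure \<Rightarrow> ('a \<Rightarrow> nat) \<Rightarrow> (nat \<Rightarrow> 'a \<Rightarrow> nat) \<Rightarrow> (real \<Rightarrow> real) \<Rightarrow> bool" where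
  "one_big_jump M X Xs x \<longleftrightarrow>
     (\<forall>t>0. x t > 0) \<and> (\<exists>T>0. mono_on {T..} x) \<and>
     (let \<mu> = (\<integral>w. real (X w) \<partial>M) in
       (\<lambda>n. SUP m\<in>{m::int. real n * \<mu> + x (real n) \<le> real_of_int m}.
          ereal \<bar>\<P>(w in M. int (\<Sum>i=1..n. Xs i w) = m) /
                  (real n * \<P>(w in M. int (X w) = \<lceil>real_of_int m - real n * \<mu>\<rceil>)) - 1\<bar>)
       \<longlonglongrightarrow> 0)"

definition intermediate_regular_variation :: "'a measure \<Rightarrow> ('a \<Rightarrow> nat) \<Rightarrow> bool" where
  "intermediate_regular_variation M X \<longleftrightarrow>
     ((\<lambda>\<epsilon>::real. liminf (\<lambda>m::nat. INF k\<in>{k::nat. 1 \<le> k \<and> \<bar>real k / real m - 1\<bar> < \<epsilon>}.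
          ereal (\<P>(w in M. X w = k) / \<P>(w in M. X w = m)))) \<longlongrightarrow> 1) (at_right 0) \<and>
     ((\<lambda>\<epsilon>::real. limsup (\<lambda>m::nat. SUP k\<in>{k::nat. 1 \<le> k \<and> \<bar>real k / real m - 1\<bar> < \<epsilon>}.
          ereal (\<P>(w in M. X w = k) / \<P>(w in M. X w = m)))) \<longlongrightarrow> 1) (at_right 0)"

definition scale_limsup :: "(real \<Rightarrow> real) \<Rightarrow> ereal" where
  "scale_limsup x = limsup (\<lambda>n::nat. ereal (x (real n) / real n))"

text \<open>
  If \<open>x n / n\<close> has limit superior \<open>\<infinity>\<close> but does not diverge to \<open>\<infinity>\<close>, the second branch
  can stay below \<open>t\<close> times the mean of \<open>X\<close> for arbitrarily large \<open>t\<close>. Example: a power-law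
  \<open>X\<close>, small \<open>\<epsilon>\<close> and \<open>\<omega>\<close>, and the step function \<open>x\<close> with value \<open>\<epsilon> * n (k+1)\<close> on
  \<open>[n k, n (k+1))\<close>, where \<open>n (k+1) / n k \<rightarrow> \<infinity>\<close>; this \<open>x\<close> satisfies \<open>one_big_jump\<close> because
  \<open>\<epsilon> * t \<le> x t\<close>.
\<close>

definition jump_threshold :: "(real \<Rightarrow> real) \<Rightarrow> real \<Rightarrow> real \<Rightarrow> real \<Rightarrow> real" where
  "jump_threshold x \<gamma> \<omega> t =
     (if scale_limsup x < \<infinity> then \<gamma> * t else (1 + \<omega>) * x ((1 + \<omega>) * t))"

definition first_max :: "nat list \<Rightarrow> nat" where
  "first_max xs = (LEAST i. i < length xs \<and> xs ! i = Max (set xs))"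

definition bulk :: "nat list \<Rightarrow> nat list" where
  "bulk xs = take (first_max xs) xs @ drop (Suc (first_max xs)) xs"

text \<open>
  Since the empty list is excluded, \<open>[X 1, \<dots>, X (N - 1)]\<close> lies in no subset of \<open>pos_seqs\<close>
  when \<open>N \<le> 1\<close>.
\<close>

definition pos_seqs :: "nat list set" where
  "pos_seqs = {xs. xs \<noteq> [] \<and> set xs \<subseteq> {1..}}"

definition segment :: "(nat \<Rightarrow> 'a \<Rightarrow> nat) \<Rightarrow> nat \<Rightarrow> 'a \<Rightarrow> nat list" where
  "segment Xs n w = map (\<lambda>i. Xs i w) [1..<Suc n]"

end

theory Submission
  imports Defs "HOL-Real_Asymp.Real_Asymp"
begin

text \<open>
  Write \<open>t = q V\<close>, \<open>\<mu> = \<rho> / q\<close> and \<open>p k = P(X = k)\<close>. In \<open>P(S_N = m) = (\<Sum>n. P(N = n) * P(S_n = m))\<close> the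
  terms with \<open>n\<close> close to \<open>t\<close> are given by (II); since \<open>m - \<mu> t\<close> is at least of order \<open>t\<close>, (III)
  replaces \<open>p (m - n \<mu>)\<close> by \<open>p (m - t \<mu>)\<close>. The other terms are negligible: (I) and the long tail
  give Kesten's bound \<open>P(S_n = m) \<le> C * u ^ n * p m\<close> for every \<open>u > 1\<close>, the Poisson law has
  exponentially small tails even when weighted by \<open>u ^ n\<close>, and \<open>p m\<close> is at most a constant times
  \<open>p (m - t \<mu>)\<close> by (III).

  For the bulk, a configuration \<open>a\<close> of \<open>n - 1\<close> entries can be completed to one of sum \<open>m\<close> by inserting
  the missing mass at any of \<open>n\<close> positions, and typically that mass exceeds all entries of \<open>a\<close>. Hence
  the conditional law of the bulk is at least \<open>n * p (m - sum a) / (t * p (m - t \<mu>)) \<approx> 1\<close> times the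
  law of \<open>(X_1, \<dots>, X_(N-1))\<close> on typical configurations.
\<close>


section \<open>Sums of independent jumps\<close>

text \<open>(II) asks for n large and m \<ge> n * \<mu> + x n, so it cannot cover every n in the
  Poisson sum, and the C of Kesten's bound may blow up as u decreases to 1. This dictates the order
  of choices: \<epsilon> fixes the width \<delta> of the window around t, the Poisson rate function
  at 1 - \<delta> and 1 + \<delta> fixes u, and only then does u fix C. Hence Kesten's bound is
  needed for every u > 1. All estimates read "eventually in t, for all m", because the suprema over
  m stand inside the limits. That the excess over the mean is of order t is used twice: for the
  shift from n * \<mu> to t * \<mu>, and for keeping the ratio of m to m - t * \<mu> bounded, so
  that p m and p (m - t * \<mu>) are comparable. The analysis takes place on
  \<open>replicate_pmf\<close>, where a configuration is a point with an explicit
  probability.\<close>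

lemma pmf_replicate_Cons:
  "pmf (replicate_pmf (Suc n) p) (x # xs) = pmf p x * pmf (replicate_pmf n p) xs"
proof -
  have "replicate_pmf (Suc n) p = map_pmf (\<lambda>(x, xs). x # xs) (pair_pmf p (replicate_pmf n p))"
    by (simp add: pair_pmf_def map_bind_pmf)
  moreover have "pmf \<dots> ((\<lambda>(x, xs). x # xs) (x, xs)) = pmf (pair_pmf p (replicate_pmf n p)) (x, xs)"
    by (rule pmf_map_inj') (auto simp: inj_on_def)
  ultimately show ?thesis by (simp add: pmf_pair)
qed

lemma pmf_replicate:
  "pmf (replicate_pmf n p) xs = (if length xs = n then prod_list (map (pmf p) xs) else 0)"
proof (induction n arbitrary: xs)
  case 0
  then show ?case by (auto simp: pmf_return indicator_def)
next
  case (Suc n)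
  show ?case
  proof (cases xs)
    case Nil
    then have "xs \<notin> set_pmf (replicate_pmf (Suc n) p)"
      by (subst set_replicate_pmf) auto
    then show ?thesis using Nil by (simp add: set_pmf_iff del: replicate_pmf.simps)
  next
    case (Cons y ys)
    then show ?thesis using Suc pmf_replicate_Cons[of n p y ys] by (simp del: replicate_pmf.simps)
  qed
qed

lemma pmf_sum_replicate_Suc:
  fixes p :: "nat pmf"
  shows "pmf (map_pmf sum_list (replicate_pmf (Suc n) p)) m =
    (\<Sum>j\<le>m. pmf p j * pmf (map_pmf sum_list (replicate_pmf n p)) (m - j))"
proof -
  let ?S = "map_pmf sum_list (replicate_pmf n p)"
  have shift: "pmf (map_pmf ((+) x) ?S) m = (if x \<le> m then pmf ?S (m - x) else 0)" for x
  proof (cases "x \<le> m")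
    case True
    then show ?thesis using pmf_map_inj'[of "(+) x" ?S "m - x"] by simp
  next
    case False
    then have "m \<notin> set_pmf (map_pmf ((+) x) ?S)" by auto
    then have "pmf (map_pmf ((+) x) ?S) m = 0" by (simp only: set_pmf_iff not_not)
    with False show ?thesis by simp
  qed
  have "map_pmf sum_list (replicate_pmf (Suc n) p) = bind_pmf p (\<lambda>x. map_pmf ((+) x) ?S)"
    by (simp add: map_bind_pmf map_pmf_def bind_assoc_pmf bind_return_pmf)
  then have "pmf (map_pmf sum_list (replicate_pmf (Suc n) p)) m =
      (\<integral>x. (if x \<le> m then pmf ?S (m - x) else 0) \<partial>p)"
    unfolding shift[symmetric] by (simp add: pmf_bind)
  also have "(\<integral>x. (if x \<le> m then pmf ?S (m - x) else 0) \<partial>p) =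
      (\<Sum>j\<le>m. (if j \<le> m then pmf ?S (m - j) else 0) * pmf p j)"
    by (rule integral_measure_pmf_real) (auto split: if_splits)
  also have "\<dots> = (\<Sum>j\<le>m. pmf p j * pmf ?S (m - j))"
    by (intro sum.cong) auto
  finally show ?thesis .
qed

section \<open>Concentration of sums of independent terms\<close>

lemma nn_integral_replicate_prod:
  fixes f :: "'a \<Rightarrow> ennreal"
  shows "(\<integral>\<^sup>+xs. prod_list (map f xs) \<partial>replicate_pmf n p) = (\<integral>\<^sup>+x. f x \<partial>p) ^ n"
  by (induction n) (simp_all add: nn_integral_cmult nn_integral_multc mult.commute)

lemma nn_integral_replicate_sum:
  fixes f :: "'a \<Rightarrow> ennreal"
  shows "(\<integral>\<^sup>+xs. sum_list (map f xs) \<partial>replicate_pmf n p) = of_nat n * (\<integral>\<^sup>+x. f x \<partial>p)"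
  by (induction n) (simp_all add: nn_integral_add algebra_simps)

lemma prod_list_exp: "prod_list (map (\<lambda>x. ennreal (exp (f x))) xs) = ennreal (exp (sum_list (map f xs)))"
  by (induction xs) (simp_all add: exp_add ennreal_mult)

text \<open>For small l > 0 the expectation of exp (l * (g x - a)) is below 1: the first-order term
  is negative, and boundedness of g makes the remainder quadratic in l. The probability then decays
  geometrically in n.\<close>

lemma chernoff_replicate:
  fixes g :: "'a \<Rightarrow> real" and p :: "'a pmf"
  assumes bnd: "\<And>x. \<bar>g x\<bar> \<le> B" and less: "measure_pmf.expectation p g < a"
  shows "(\<lambda>n. measure_pmf.prob (replicate_pmf n p) {xs. a * real n \<le> sum_list (map g xs)}) \<longlonglongrightarrow> 0"
proof -
  have int: "integrable p g"
    by (rule measure_pmf.integrable_const_bound[where B = B]) (use bnd in auto)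
  define D where "D = B + \<bar>a\<bar> + 1"
  have B: "B \<ge> 0" using bnd[of undefined] by linarith
  have D: "D \<ge> 1" "\<bar>g x - a\<bar> \<le> D" for x
    using bnd[of x] B unfolding D_def by linarith+
  define d where "d = a - measure_pmf.expectation p g"
  have d: "d > 0" using less by (simp add: d_def)
  \<comment> \<open>The first entry keeps l * (g x - a) in [-1, 1], where the quadratic bound on exp
    holds; the second makes the quadratic term at most half of the linear gain l * d.\<close>
  define l where "l = min (1 / D) (d / (2 * D\<^sup>2))"
  have l: "l > 0" "l * D \<le> 1" "l * D\<^sup>2 \<le> d / 2"
  proof -
    show "l > 0" using D d by (auto simp: l_def)
    have "l * D \<le> (1 / D) * D" using D by (intro mult_right_mono) (auto simp: l_def)
    then show "l * D \<le> 1" using D by simp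
    have "l * D\<^sup>2 \<le> (d / (2 * D\<^sup>2)) * D\<^sup>2" using D by (intro mult_right_mono) (auto simp: l_def)
    then show "l * D\<^sup>2 \<le> d / 2" using D by simp
  qed
  define r where "r = 1 - l * d / 2"
  have pw: "exp (l * (g x - a)) \<le> 1 + l * (g x - a) + l\<^sup>2 * D\<^sup>2" for x
  proof -
    have ab: "\<bar>l * (g x - a)\<bar> \<le> l * D" using D(2)[of x] l(1) by (simp add: abs_mult)
    have "exp (l * (g x - a)) \<le> 1 + l * (g x - a) + (l * (g x - a))\<^sup>2"
    proof (cases "l * (g x - a) \<ge> 0")
      case True
      then show ?thesis using exp_bound[of "l * (g x - a)"] ab l(2) by linarith
    next
      case False
      \<comment> \<open>\<open>exp_bound\<close> covers nonnegative arguments; for negative ones the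
        quadratic bound comes from exp (- z) \<le> 1 / (1 + z).\<close>
      define z where "z = - (l * (g x - a))"
      have z: "z > 0" "z \<le> 1" using False ab l(2) by (auto simp: z_def)
      have "exp (-z) \<le> 1 / (1 + z)"
        using exp_ge_add_one_self[of z] z by (simp add: exp_minus field_simps)
      also have "\<dots> \<le> 1 - z + z\<^sup>2"
        using z by (simp add: field_simps power2_eq_square)
      finally show ?thesis by (simp add: z_def)
    qed
    also have "(l * (g x - a))\<^sup>2 \<le> (l * D)\<^sup>2"
      using ab by (metis abs_le_square_iff abs_of_nonneg abs_ge_zero order.trans)
    finally show ?thesis by (simp add: power_mult_distrib)
  qed
  have inte: "integrable p (\<lambda>x. exp (l * (g x - a)))"
    by (rule measure_pmf.integrable_const_bound[where B = "exp (l * D)"])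
      (use D(2) l(1) in \<open>auto simp: abs_le_iff\<close>)
  have "measure_pmf.expectation p (\<lambda>x. exp (l * (g x - a))) \<le>
      measure_pmf.expectation p (\<lambda>x. 1 + l * (g x - a) + l\<^sup>2 * D\<^sup>2)"
    by (intro integral_mono inte pw Bochner_Integration.integrable_add integrable_mult_right
        Bochner_Integration.integrable_diff int integrable_const measure_pmf.finite_measure_axioms) auto
  also have "\<dots> = 1 - l * d + l\<^sup>2 * D\<^sup>2"
    using int by (simp add: d_def algebra_simps)
  also have "l\<^sup>2 * D\<^sup>2 \<le> l * (d / 2)"
    using mult_left_mono[OF l(3), of l] l(1) by (simp add: power2_eq_square mult_ac)
  finally have E: "measure_pmf.expectation p (\<lambda>x. exp (l * (g x - a))) \<le> r"
    by (simp add: r_def mult.commute[of d])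
  have r0: "0 \<le> r"
    by (rule order.trans[OF _ E]) simp
  have r1: "r < 1" using l(1) d by (simp add: r_def)
  have bound: "measure_pmf.prob (replicate_pmf n p) {xs. a * real n \<le> sum_list (map g xs)} \<le> r ^ n" for n
  proof -
    let ?R = "replicate_pmf n p"
    have "emeasure ?R {xs. a * real n \<le> sum_list (map g xs)} =
        (\<integral>\<^sup>+xs. indicator {xs. a * real n \<le> sum_list (map g xs)} xs \<partial>?R)"
      by simp
    also have "\<dots> \<le> (\<integral>\<^sup>+xs. prod_list (map (\<lambda>x. ennreal (exp (l * (g x - a)))) xs) \<partial>?R)"
    proof (intro nn_integral_mono_AE, unfold AE_measure_pmf_iff, intro ballI)
      fix xs assume "xs \<in> set_pmf ?R"
      then have len: "length xs = n" by (subst (asm) set_replicate_pmf) auto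
      have sm: "sum_list (map (\<lambda>x. l * (g x - a)) xs) = l * (sum_list (map g xs) - a * real (length xs))"
        by (induction xs) (simp_all add: algebra_simps)
      show "indicator {xs. a * real n \<le> sum_list (map g xs)} xs \<le>
          prod_list (map (\<lambda>x. ennreal (exp (l * (g x - a)))) xs)"
        using l(1) by (auto simp: prod_list_exp sm len indicator_def)
    qed
    also have "\<dots> = (\<integral>\<^sup>+x. ennreal (exp (l * (g x - a))) \<partial>p) ^ n"
      by (rule nn_integral_replicate_prod)
    also have "(\<integral>\<^sup>+x. ennreal (exp (l * (g x - a))) \<partial>p) =
        ennreal (measure_pmf.expectation p (\<lambda>x. exp (l * (g x - a))))"
      by (rule nn_integral_eq_integral[OF inte]) auto
    also have "\<dots> ^ n \<le> ennreal r ^ n"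
      by (intro power_mono ennreal_leI E) auto
    also have "\<dots> = ennreal (r ^ n)" using r0 by (simp add: ennreal_power)
    finally show ?thesis
      using r0 by (simp add: measure_pmf.emeasure_eq_measure)
  qed
  show ?thesis
    by (rule tendsto_sandwich[OF _ _ tendsto_const LIMSEQ_realpow_zero[OF r0 r1]])
      (use bound in auto)
qed

text \<open>For the part of a jump above a truncation level only a first moment is available. The
  bound is uniform in n and small as soon as the expectation of h is.\<close>

lemma markov_replicate:
  fixes h :: "'a \<Rightarrow> real" and p :: "'a pmf"
  assumes h: "\<And>x. h x \<ge> 0" "integrable p h" and "e > 0" "n > 0"
  shows "measure_pmf.prob (replicate_pmf n p) {xs. e * real n \<le> sum_list (map h xs)} \<le>
    measure_pmf.expectation p h / e"
proof -
  let ?R = "replicate_pmf n p"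
  have sm: "sum_list (map (\<lambda>x. ennreal (h x)) xs) = ennreal (sum_list (map h xs))" for xs
    by (rule sum_list_ennreal) (use h(1) in auto)
  have scaled: "1 \<le> ennreal (1 / (e * real n)) * ennreal y \<longleftrightarrow> e * real n \<le> y" for y
  proof -
    have "ennreal (1 / (e * real n)) * ennreal y = ennreal (y / (e * real n))"
      using assms(3,4) by (simp flip: ennreal_mult')
    then show ?thesis using assms(3,4) by (simp add: field_simps)
  qed
  have c: "{xs. e * real n \<le> sum_list (map h xs)} =
      {xs \<in> space ?R. 1 \<le> ennreal (1 / (e * real n)) * sum_list (map (\<lambda>x. ennreal (h x)) xs)}"
    by (simp add: sm scaled)
  have "emeasure ?R {xs. e * real n \<le> sum_list (map h xs)} \<le>
      ennreal (1 / (e * real n)) * (\<integral>\<^sup>+xs. sum_list (map (\<lambda>x. ennreal (h x)) xs) * indicator (space ?R) xs \<partial>?R)"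
    unfolding c by (rule order.trans[OF nn_integral_Markov_inequality]) auto
  also have "(\<integral>\<^sup>+xs. sum_list (map (\<lambda>x. ennreal (h x)) xs) * indicator (space ?R) xs \<partial>?R) =
      of_nat n * ennreal (measure_pmf.expectation p h)"
  proof -
    have "(\<integral>\<^sup>+x. ennreal (h x) \<partial>p) = ennreal (measure_pmf.expectation p h)"
      by (rule nn_integral_eq_integral[OF h(2)]) (use h(1) in auto)
    then show ?thesis by (simp add: nn_integral_replicate_sum del: sum_list_ennreal)
  qed
  also have "ennreal (1 / (e * real n)) * \<dots> = ennreal (1 / (e * real n) * (real n * measure_pmf.expectation p h))"
    using assms by (simp add: ennreal_of_nat_eq_real_of_nat flip: ennreal_mult)
  finally show ?thesis
    using assms by (simp add: measure_pmf.emeasure_eq_measure ennreal_le_iff)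
qed

text \<open>Truncation at a level b: the bounded part min x b obeys Chernoff bounds on both sides,
  and the excess x - b has small mean. The sum of the excesses also controls the largest entry,
  which the bulk needs: once b \<le> \<eta> * k / 2, a single entry above \<eta> * k pushes that sum
  over \<eta> * k / 2.\<close>

lemma weak_law_replicate:
  fixes p :: "nat pmf"
  assumes int: "integrable p real" and "\<eta> > 0" "e > 0"
  defines "\<mu> \<equiv> measure_pmf.expectation p real"
  shows "\<forall>\<^sub>F k in sequentially. measure_pmf.prob (replicate_pmf k p)
    {xs. \<eta> * real k < \<bar>real (sum_list xs) - \<mu> * real k\<bar> \<or> (\<exists>x\<in>set xs. \<eta> * real k < real x)} \<le> e"
proof -
  have inth: "integrable p (\<lambda>x. real (x - b))" for b
    by (rule Bochner_Integration.integrable_bound[OF int]) auto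
  have intg: "integrable p (\<lambda>x. real (min x b))" for b
    by (rule Bochner_Integration.integrable_bound[OF int]) auto
  have lim: "(\<lambda>b. measure_pmf.expectation p (\<lambda>x. real (x - b))) \<longlonglongrightarrow> measure_pmf.expectation p (\<lambda>x. 0)"
  proof (rule integral_dominated_convergence[OF _ _ int])
    show "AE x in p. (\<lambda>b. real (x - b)) \<longlonglongrightarrow> 0"
    proof (rule AE_I2)
      fix x :: nat
      have "\<forall>\<^sub>F b in sequentially. real (x - b) = 0"
        using eventually_ge_at_top[of x] by eventually_elim simp
      then show "(\<lambda>b. real (x - b)) \<longlonglongrightarrow> 0" by (rule tendsto_eventually)
    qed
  qed auto
  \<comment> \<open>The first bound keeps the truncated mean within \<eta> / 2 of \<mu>; the second
    turns Markov's inequality at level \<eta> / 2 into probability e / 3.\<close>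
  have "min (\<eta> / 2) (e * \<eta> / 6) > 0" using assms by auto
  from order_tendstoD(2)[OF lim, unfolded integral_zero, OF this] have "\<forall>\<^sub>F b in sequentially.
      measure_pmf.expectation p (\<lambda>x. real (x - b)) < min (\<eta> / 2) (e * \<eta> / 6)" .
  then obtain b where b: "measure_pmf.expectation p (\<lambda>x. real (x - b)) < min (\<eta> / 2) (e * \<eta> / 6)"
    by (auto simp: eventually_sequentially)
  have split: "real x = real (min x b) + real (x - b)" for x by simp
  have "\<mu> = measure_pmf.expectation p (\<lambda>x. real (min x b) + real (x - b))"
    unfolding \<mu>_def by (intro Bochner_Integration.integral_cong refl split)
  also have "\<dots> = measure_pmf.expectation p (\<lambda>x. real (min x b)) + measure_pmf.expectation p (\<lambda>x. real (x - b))"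
    by (rule Bochner_Integration.integral_add[OF intg inth])
  finally have \<mu>: "\<mu> = measure_pmf.expectation p (\<lambda>x. real (min x b)) + measure_pmf.expectation p (\<lambda>x. real (x - b))" .
  have hpos: "measure_pmf.expectation p (\<lambda>x. real (x - b)) \<ge> 0" by simp
  define A1 where "A1 k = {xs. (\<mu> + \<eta> / 2) * real k \<le> sum_list (map (\<lambda>x. real (min x b)) xs)}" for k
  define A2 where "A2 k = {xs. (\<eta> - \<mu>) * real k \<le> sum_list (map (\<lambda>x. - real (min x b)) xs)}" for k
  define A3 where "A3 k = {xs. (\<eta> / 2) * real k \<le> sum_list (map (\<lambda>x. real (x - b)) xs)}" for k
  have l1: "(\<lambda>k. measure_pmf.prob (replicate_pmf k p) (A1 k)) \<longlonglongrightarrow> 0"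
    unfolding A1_def by (rule chernoff_replicate[where B = b], simp, use \<mu> hpos assms(2) in linarith)
  have l2: "(\<lambda>k. measure_pmf.prob (replicate_pmf k p) (A2 k)) \<longlonglongrightarrow> 0"
    unfolding A2_def by (rule chernoff_replicate[where B = b], simp, subst integral_minus, use \<mu> b assms(2) in linarith)
  have "e / 3 > 0" using assms by simp
  note ev = order_tendstoD(2)[OF l1 this] order_tendstoD(2)[OF l2 this]
  have "\<forall>\<^sub>F k in sequentially. 2 * real b / \<eta> \<le> real k" by real_asymp
  with ev eventually_gt_at_top[of 0] show ?thesis
  proof eventually_elim
    case (elim k)
    let ?P = "measure_pmf.prob (replicate_pmf k p)"
    have kb: "real b \<le> \<eta> / 2 * real k" using elim assms(2) by (simp add: field_simps)
    have "?P (A3 k) \<le> measure_pmf.expectation p (\<lambda>x. real (x - b)) / (\<eta> / 2)"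
      unfolding A3_def by (rule markov_replicate) (use inth elim assms(2) in auto)
    also have "\<dots> \<le> e / 3" using b assms(2) by (simp add: field_simps)
    finally have 3: "?P (A3 k) \<le> e / 3" .
    have "{xs. \<eta> * real k < \<bar>real (sum_list xs) - \<mu> * real k\<bar> \<or> (\<exists>x\<in>set xs. \<eta> * real k < real x)}
        \<subseteq> A1 k \<union> (A2 k \<union> A3 k)"
    proof (rule subsetI, rule ccontr)
      fix xs assume xs: "xs \<in> {xs. \<eta> * real k < \<bar>real (sum_list xs) - \<mu> * real k\<bar> \<or>
          (\<exists>x\<in>set xs. \<eta> * real k < real x)}" and n: "xs \<notin> A1 k \<union> (A2 k \<union> A3 k)"
      define G where "G = sum_list (map (\<lambda>x. real (min x b)) xs)"
      define H where "H = sum_list (map (\<lambda>x. real (x - b)) xs)"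
      have m: "sum_list (map (\<lambda>x. - real (min x b)) xs) = - G"
        unfolding G_def by (induction xs) auto
      have gh: "real (sum_list xs) = G + H"
        unfolding G_def H_def by (induction xs) (auto simp: algebra_simps)
      have H0: "H \<ge> 0" unfolding H_def by (rule sum_list_nonneg) auto
      have n': "G < (\<mu> + \<eta> / 2) * real k" "- G < (\<eta> - \<mu>) * real k" "H < \<eta> / 2 * real k"
        using n by (auto simp: A1_def A2_def A3_def m simp flip: G_def H_def)
      have "\<not> \<eta> * real k < \<bar>real (sum_list xs) - \<mu> * real k\<bar>"
        using n' H0 unfolding gh by (auto simp: algebra_simps abs_less_iff abs_if)
      with xs obtain x where x: "x \<in> set xs" "\<eta> * real k < real x" by auto
      have "real (x - b) \<le> H"
        unfolding H_def by (rule member_le_sum_list) (use x in auto)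
      with x kb n'(3) show False by (auto simp: of_nat_diff split: if_splits)
    qed
    then have "?P {xs. \<eta> * real k < \<bar>real (sum_list xs) - \<mu> * real k\<bar> \<or> (\<exists>x\<in>set xs. \<eta> * real k < real x)}
        \<le> ?P (A1 k \<union> (A2 k \<union> A3 k))"
      by (intro measure_pmf.finite_measure_mono) auto
    also have "\<dots> \<le> ?P (A1 k) + ?P (A2 k \<union> A3 k)" by (rule measure_Un_le) auto
    also have "?P (A2 k \<union> A3 k) \<le> ?P (A2 k) + ?P (A3 k)" by (rule measure_Un_le) auto
    also have "?P (A1 k) + (?P (A2 k) + ?P (A3 k)) \<le> e" using elim 3 by linarith
    finally show ?case by simp
  qed
qed


section \<open>Poisson deviations\<close>

lemma poisson_sums: "(\<lambda>n. t ^ n / fact n * exp (- t) * u ^ n) sums exp (t * u - t :: real)"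
proof -
  have "(\<lambda>n. (t * u) ^ n /\<^sub>R fact n) sums exp (t * u)"
    by (rule exp_converges)
  then have "(\<lambda>n. exp (- t) * ((t * u) ^ n /\<^sub>R fact n)) sums (exp (- t) * exp (t * u))"
    by (rule sums_mult)
  then show ?thesis
    by (simp add: power_mult_distrib divide_inverse mult_ac mult_exp_exp)
qed

text \<open>Exponential tilting: on the deviation event, \<open>u ^ n\<close> is dominated by
  \<open>(u * r) ^ n * r powr (- r * t)\<close> with \<open>r = 1 + \<delta>\<close> above and \<open>r = 1 - \<delta>\<close> below the mean.\<close>

lemma poisson_tilted_tail:
  assumes "0 < \<delta>" "\<delta> < 1"
  obtains u :: real where "u > 1"
    "\<And>t. t > 0 \<Longrightarrow> summable (\<lambda>n. pmf (poisson_pmf t) n * (u ^ n * of_bool (\<delta> * t < \<bar>real n - t\<bar>)))"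
    "((\<lambda>t. \<Sum>n. pmf (poisson_pmf t) n * (u ^ n * of_bool (\<delta> * t < \<bar>real n - t\<bar>))) \<longlongrightarrow> 0) at_top"
proof -
  \<comment> \<open>The large-deviation rate function of the Poisson law; on r > 0 it vanishes only
    at r = 1.\<close>
  define I where "I r = r * ln r - r + 1" for r :: real
  have I: "I r > 0" if "r > 0" "r \<noteq> 1" for r
  proof -
    have "ln (inverse r) < inverse r - 1"
      using that ln_le_minus_one[of "inverse r"] ln_eq_minus_one[of "inverse r"] by fastforce
    then have "r * (- ln r) < r * (inverse r - 1)"
      using that by (intro mult_strict_left_mono) (auto simp: ln_inverse)
    then show ?thesis using that by (simp add: I_def algebra_simps)
  qed
  define h where "h = min (I (1 + \<delta>)) (I (1 - \<delta>))"
  have h: "h > 0" using I assms by (auto simp: h_def)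
  \<comment> \<open>For r \<le> 2 the weight u ^ n costs a factor exp (t * e * r) \<le> exp (h * t /
    2) in the tilted sum, half of the exponent gained from the rate function.\<close>
  define e where "e = h / 4"
  define u where "u = 1 + e"
  have u: "u > 1" using h by (simp add: u_def e_def)
  define T where "T t n = pmf (poisson_pmf t) n * (u ^ n * of_bool (\<delta> * t < \<bar>real n - t\<bar>))" for t n
  define D where "D r t n = exp (- (r * ln r * t)) * (t ^ n / fact n * exp (- t) * (u * r) ^ n)" for r t :: real and n
  have Dsum: "D r t sums exp (- (r * ln r * t) + (t * (u * r) - t))" for r t
    unfolding D_def exp_add by (intro sums_mult poisson_sums)
  have TD: "T t n \<le> D (1 + \<delta>) t n + D (1 - \<delta>) t n" if "t > 0" for t n
  proof (cases "\<delta> * t < \<bar>real n - t\<bar>")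
    case False
    then show ?thesis using that u assms by (auto simp: T_def D_def intro!: add_nonneg_nonneg)
  next
    case True
    \<comment> \<open>\<open>D r t n\<close> is the Poisson weight times u ^ n times r powr (n - r *
      t), and the last factor is at least 1 when n lies beyond r * t as seen from t.\<close>
    have key: "T t n \<le> D r t n" if r: "r > 0" "ln r * (real n - r * t) \<ge> 0" for r
    proof -
      have "1 \<le> exp (ln r * (real n - r * t))" using r by simp
      also have "\<dots> = exp (- (r * ln r * t)) * r ^ n"
      proof -
        have "ln r * (real n - r * t) = - (r * ln r * t) + real n * ln r"
          by (simp add: algebra_simps)
        then show ?thesis using r(1) by (simp add: exp_diff exp_minus exp_of_nat_mult field_simps)
      qed
      finally have "u ^ n * 1 \<le> u ^ n * (exp (- (r * ln r * t)) * r ^ n)"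
        using u by (intro mult_left_mono) auto
      then have "(t ^ n / fact n * exp (- t)) * u ^ n \<le>
          (t ^ n / fact n * exp (- t)) * (u ^ n * (exp (- (r * ln r * t)) * r ^ n))"
        using \<open>t > 0\<close> by (intro mult_left_mono) auto
      then show ?thesis using True \<open>t > 0\<close> by (simp add: T_def D_def power_mult_distrib mult_ac)
    qed
    have D0: "D r t n \<ge> 0" if "r > 0" for r using that u \<open>t > 0\<close> by (auto simp: D_def)
    show ?thesis
    proof (cases "real n > t")
      case True': True
      have "T t n \<le> D (1 + \<delta>) t n"
      proof (rule key)
        show "ln (1 + \<delta>) * (real n - (1 + \<delta>) * t) \<ge> 0"
          using True True' assms by (intro mult_nonneg_nonneg) (auto simp: algebra_simps)
      qed (use assms in auto)
      then show ?thesis using D0[of "1 - \<delta>"] assms by auto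
    next
      case False
      have "T t n \<le> D (1 - \<delta>) t n"
      proof (rule key)
        show "ln (1 - \<delta>) * (real n - (1 - \<delta>) * t) \<ge> 0"
          using True False assms by (intro mult_nonpos_nonpos) (auto simp: algebra_simps)
      qed (use assms in auto)
      then show ?thesis using D0[of "1 + \<delta>"] assms by auto
    qed
  qed
  have T0: "T t n \<ge> 0" if "t > 0" for t n using u that by (auto simp: T_def)
  have expo: "exp (- (r * ln r * t) + (t * (u * r) - t)) \<le> exp (- (h / 2) * t)"
    if "t > 0" "h \<le> I r" "0 < r" "r \<le> 2" for r t
  proof -
    have "- (r * ln r * t) + (t * (u * r) - t) = t * (e * r - I r)"
      by (simp add: I_def u_def algebra_simps)
    also have "\<dots> \<le> t * (- (h / 2))"
    proof (rule mult_left_mono)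
      have "e * r \<le> e * 2" using that h by (intro mult_left_mono) (auto simp: e_def)
      then show "e * r - I r \<le> - (h / 2)" using that by (simp add: e_def)
    qed (use that in auto)
    finally show ?thesis by (simp add: mult.commute)
  qed
  have Tsum: "summable (T t)" if "t > 0" for t
    by (rule summable_comparison_test'[OF sums_summable[OF
        sums_add[OF Dsum[of "1 + \<delta>" t] Dsum[of "1 - \<delta>" t]]], of 0]) (use TD T0 that in auto)
  have bound: "(\<Sum>n. T t n) \<le> 2 * exp (- (h / 2) * t)" if "t > 0" for t
  proof -
    note S = sums_add[OF Dsum[of "1 + \<delta>" t] Dsum[of "1 - \<delta>" t]]
    have "(\<Sum>n. T t n) \<le> (\<Sum>n. D (1 + \<delta>) t n + D (1 - \<delta>) t n)"
      by (intro suminf_le TD that sums_summable[OF S] Tsum)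
    also have "\<dots> = exp (- ((1 + \<delta>) * ln (1 + \<delta>) * t) + (t * (u * (1 + \<delta>)) - t)) +
        exp (- ((1 - \<delta>) * ln (1 - \<delta>) * t) + (t * (u * (1 - \<delta>)) - t))"
      by (rule sums_unique[OF S, symmetric])
    also have "\<dots> \<le> exp (- (h / 2) * t) + exp (- (h / 2) * t)"
      by (intro add_mono expo) (use that assms in \<open>auto simp: h_def\<close>)
    finally show ?thesis by simp
  qed
  have nonneg: "0 \<le> (\<Sum>n. T t n)" if "t > 0" for t
    by (intro suminf_nonneg Tsum T0 that)
  have lim: "((\<lambda>t. 2 * exp (- (h / 2) * t)) \<longlongrightarrow> 0) at_top"
    using h by real_asymp
  have "((\<lambda>t. \<Sum>n. T t n) \<longlongrightarrow> 0) at_top"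
  proof (rule tendsto_sandwich[OF _ _ tendsto_const lim])
    show "\<forall>\<^sub>F t in at_top. 0 \<le> (\<Sum>n. T t n)"
      using eventually_gt_at_top[of 0] by eventually_elim (rule nonneg)
    show "\<forall>\<^sub>F t in at_top. (\<Sum>n. T t n) \<le> 2 * exp (- (h / 2) * t)"
      using eventually_gt_at_top[of 0] by eventually_elim (rule bound)
  qed
  then show ?thesis using that u Tsum unfolding T_def by blast
qed


section \<open>Kesten's bound and intermediate regular variation\<close>

locale positive_law =
  fixes p :: "nat pmf"
  assumes pmf_0: "pmf p 0 = 0" and pmf_pos: "\<And>k. k \<ge> 1 \<Longrightarrow> 0 < pmf p k"
begin

definition conv :: "nat \<Rightarrow> nat \<Rightarrow> real" where
  "conv n m = pmf (map_pmf sum_list (replicate_pmf n p)) m"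

lemma conv_0: "conv 0 m = of_bool (m = 0)"
  by (simp add: conv_def indicator_def)

lemma conv_Suc: "conv (Suc n) m = (\<Sum>j\<le>m. pmf p j * conv n (m - j))"
  unfolding conv_def by (rule pmf_sum_replicate_Suc)

lemma conv_nonneg: "0 \<le> conv n m"
  by (simp add: conv_def)

lemma conv_le_1: "conv n m \<le> 1"
  unfolding conv_def by (rule pmf_le_1)

lemma conv_1: "conv 1 m = pmf p m"
proof -
  have "conv 1 m = (\<Sum>j\<le>m. pmf p j * of_bool (j = m))"
    unfolding One_nat_def conv_Suc by (intro sum.cong) (auto simp: conv_0)
  also have "\<dots> = pmf p m" by (simp add: of_bool_def if_distrib sum.delta cong: if_cong)
  finally show ?thesis .
qed

lemma conv_2: "conv 2 m = (\<Sum>r\<le>m. pmf p (m - r) * pmf p r)"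
proof -
  have "conv 2 m = (\<Sum>j\<le>m. pmf p j * pmf p (m - j))"
    unfolding numeral_2_eq_2 conv_Suc[of 1, unfolded One_nat_def] conv_1[unfolded One_nat_def] ..
  also have "\<dots> = (\<Sum>r\<le>m. pmf p (m - r) * pmf p r)"
    by (rule sum.reindex_bij_witness[of _ "\<lambda>r. m - r" "\<lambda>r. m - r"]) auto
  finally show ?thesis .
qed

lemma conv_Suc': "conv (Suc n) m = (\<Sum>r\<le>m. pmf p (m - r) * conv n r)"
  unfolding conv_Suc by (rule sum.reindex_bij_witness[of _ "\<lambda>r. m - r" "\<lambda>r. m - r"]) auto

text \<open>Assumption (III), with the limits over \<open>\<epsilon>\<close> and \<open>m\<close> unfolded.\<close>

definition irv :: bool where
  "irv \<longleftrightarrow> (\<forall>\<epsilon>>0. \<exists>\<eta>>0. \<forall>\<^sub>F m in sequentially. \<forall>k\<ge>1.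
     \<bar>real k / real m - 1\<bar> < \<eta> \<longrightarrow> \<bar>pmf p k / pmf p m - 1\<bar> \<le> \<epsilon>)"

text \<open>A fixed shift r changes m by the relative amount r / m, which is eventually below any
  \<eta>.\<close>

lemma irv_imp_long_tailed:
  assumes irv
  shows "(\<lambda>m. pmf p (m - r) / pmf p m) \<longlonglongrightarrow> 1"
proof (rule LIMSEQ_I)
  fix e :: real assume "e > 0"
  then have "e / 2 > 0" by simp
  with assms obtain \<eta> where \<eta>: "\<eta> > 0" "\<forall>\<^sub>F m in sequentially. \<forall>k\<ge>1.
     \<bar>real k / real m - 1\<bar> < \<eta> \<longrightarrow> \<bar>pmf p k / pmf p m - 1\<bar> \<le> e / 2"
    unfolding irv_def by blast
  have "\<forall>\<^sub>F m in sequentially. real r / \<eta> < real m" by real_asymp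
  with \<eta>(2) eventually_gt_at_top[of r]
  have "\<forall>\<^sub>F m in sequentially. norm (pmf p (m - r) / pmf p m - 1) < e"
  proof eventually_elim
    case (elim m)
    have "\<bar>real (m - r) / real m - 1\<bar> = real r / real m"
      using elim by (simp add: of_nat_diff field_simps)
    also have "\<dots> < \<eta>" using elim \<eta>(1) by (simp add: field_simps)
    finally have "\<bar>pmf p (m - r) / pmf p m - 1\<bar> \<le> e / 2" using elim by auto
    then show ?case using \<open>e > 0\<close> by simp
  qed
  then show "\<exists>no. \<forall>n\<ge>no. norm (pmf p (n - r) / pmf p n - 1) < e"
    by (simp add: eventually_sequentially)
qed

lemma sum_pmf_tendsto: "(\<lambda>K. \<Sum>r<K. pmf p r) \<longlonglongrightarrow> 1"
proof -
  have "(\<lambda>K. measure_pmf.prob p {..<K}) \<longlonglongrightarrow> measure_pmf.prob p (\<Union>K. {..<K})"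
    by (rule measure_pmf.finite_Lim_measure_incseq) (auto simp: incseq_def)
  moreover have "(\<Union>K. {..<K}) = (UNIV :: nat set)" by auto
  ultimately show ?thesis by (simp add: measure_measure_pmf_finite)
qed

text \<open>Kesten's bound: in the convolution of \<open>n + 1\<close> jumps, either the first \<open>n\<close> sum to less than
  \<open>K\<close>, and the long tail applies, or subexponentiality of the convolution square does.\<close>

lemma kesten_bound:
  assumes subexp: "(\<lambda>m. conv 2 m / (2 * pmf p m)) \<longlonglongrightarrow> 1" and irv and "\<epsilon> > 0"
  obtains C where "C > 0" "\<And>n m. m \<ge> 1 \<Longrightarrow> conv n m \<le> C * (1 + \<epsilon>) ^ n * pmf p m"
proof -
  \<comment> \<open>The tail sum gets the share 2 * (1 + e) - (1 - e)^2 \<le> 1 + 5 * e, so a fifth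
    of \<epsilon> suffices.\<close>
  define e where "e = min \<epsilon> 1 / 5"
  have e: "0 < e" "e \<le> 1 / 5" "5 * e \<le> \<epsilon>" using assms by (auto simp: e_def)
  have "\<forall>\<^sub>F K in sequentially. (\<Sum>r<K. pmf p r) > 1 - e"
    using order_tendstoD(1)[OF sum_pmf_tendsto, of "1 - e"] e by simp
  then obtain K where K: "(\<Sum>r<K. pmf p r) > 1 - e" by (auto simp: eventually_sequentially)
  have lt: "\<forall>\<^sub>F m in sequentially. \<forall>r\<in>{..<K}. \<bar>pmf p (m - r) / pmf p m - 1\<bar> < e"
    by (rule eventually_ball_finite)
      (use tendstoD[OF irv_imp_long_tailed[OF assms(2)] e(1)] in \<open>auto simp: dist_real_def\<close>)
  have sq: "\<forall>\<^sub>F m in sequentially. conv 2 m / (2 * pmf p m) < 1 + e"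
    using order_tendstoD(2)[OF subexp, of "1 + e"] e by simp
  obtain M where M: "\<And>m r. m \<ge> M \<Longrightarrow> r < K \<Longrightarrow> \<bar>pmf p (m - r) / pmf p m - 1\<bar> < e"
      "\<And>m. m \<ge> M \<Longrightarrow> conv 2 m / (2 * pmf p m) < 1 + e" "M \<ge> 1" "M \<ge> K"
    using eventually_conj[OF eventually_conj[OF lt sq]
        eventually_conj[OF eventually_ge_at_top[of 1] eventually_ge_at_top[of K]]]
    unfolding eventually_sequentially by (metis lessThan_iff order.refl order.trans)
  have low: "(1 - e) * pmf p m \<le> pmf p (m - r)" "pmf p (m - r) \<le> (1 + e) * pmf p m"
    if "m \<ge> M" "r < K" for m r
    using M(1)[OF that] M(3) that pmf_pos[of m] by (auto simp: abs_less_iff field_simps)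
  \<comment> \<open>The convolution square is about 2 * p m. By the long tail the terms with r < K
    already take about p m of it, which leaves about one p m for all the others.\<close>
  have tail: "(\<Sum>r\<in>{K..m}. pmf p (m - r) * pmf p r) \<le> (1 + \<epsilon>) * pmf p m" if "m \<ge> M" for m
  proof -
    have pm: "pmf p m > 0" using that M(3) by (intro pmf_pos) auto
    have "{..m} = {..<K} \<union> {K..m}" using that M(4) by auto
    then have "conv 2 m = (\<Sum>r<K. pmf p (m - r) * pmf p r) + (\<Sum>r\<in>{K..m}. pmf p (m - r) * pmf p r)"
      unfolding conv_2 by (simp add: sum.union_disjoint ivl_disj_int)
    moreover have "(1 - e) * (1 - e) * pmf p m \<le> (\<Sum>r<K. pmf p (m - r) * pmf p r)"
    proof -
      have "(1 - e) * (1 - e) \<le> (1 - e) * (\<Sum>r<K. pmf p r)"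
        using K e by (intro mult_left_mono) auto
      then have "(1 - e) * (1 - e) * pmf p m \<le> (1 - e) * (\<Sum>r<K. pmf p r) * pmf p m"
        using pm by (intro mult_right_mono) auto
      also have "\<dots> = (\<Sum>r<K. (1 - e) * pmf p m * pmf p r)"
        by (simp add: sum_distrib_left sum_distrib_right mult_ac)
      also have "\<dots> \<le> (\<Sum>r<K. pmf p (m - r) * pmf p r)"
        by (intro sum_mono mult_right_mono low that) auto
      finally show ?thesis .
    qed
    moreover have "conv 2 m \<le> 2 * (1 + e) * pmf p m"
      using M(2)[OF that] pm by (simp add: field_simps)
    ultimately have "(\<Sum>r\<in>{K..m}. pmf p (m - r) * pmf p r) \<le> (2 * (1 + e) - (1 - e) * (1 - e)) * pmf p m"
      by (simp add: algebra_simps)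
    also have "\<dots> \<le> (1 + \<epsilon>) * pmf p m"
    proof (rule mult_right_mono)
      have "2 * (1 + e) - (1 - e) * (1 - e) \<le> 1 + 5 * e" using e by (simp add: algebra_simps)
      then show "2 * (1 + e) - (1 - e) * (1 - e) \<le> 1 + \<epsilon>" using e by linarith
    qed (use pm in auto)
    finally show ?thesis .
  qed
  \<comment> \<open>The sum of reciprocals makes C0 * p m \<ge> 1 for m \<le> M, where
    \<open>conv_le_1\<close> is enough; 2 * K pays for the K terms in which the n jumps sum to less
    than K.\<close>
  define C0 where "C0 = (\<Sum>k\<in>{1..M}. 1 / pmf p k) + 2 * K"
  have C0: "1 / pmf p m \<le> C0" if "1 \<le> m" "m \<le> M" for m
  proof -
    have "1 / pmf p m \<le> (\<Sum>k\<in>{1..M}. 1 / pmf p k)"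
      by (rule member_le_sum) (use that in auto)
    then show ?thesis by (simp add: C0_def)
  qed
  have C0_nonneg: "C0 \<ge> 0" "2 * K \<le> C0" by (auto simp: C0_def intro!: add_nonneg_nonneg sum_nonneg)
  \<comment> \<open>The solution with a 0 = 1 of the recursion \<open>a_Suc\<close> that the
    induction produces.\<close>
  define a where "a n = (1 + C0 / \<epsilon>) * (1 + \<epsilon>) ^ n - C0 / \<epsilon>" for n
  have a_Suc: "a (Suc n) = (1 + \<epsilon>) * a n + C0" for n
    using assms(3) by (simp add: a_def field_simps)
  have a0: "a n \<ge> 0" for n
    by (induction n) (use a_Suc C0_nonneg assms(3) in \<open>auto simp: a_def\<close>)
  have "conv n m \<le> a n * pmf p m" if "m \<ge> 1" for n m
    using that
  proof (induction n arbitrary: m)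
    case 0
    then show ?case using a0[of 0] by (simp add: conv_0)
  next
    case (Suc n)
    have pm: "pmf p m > 0" using Suc.prems by (rule pmf_pos)
    show ?case
    proof (cases "m \<ge> M")
      case False
      have "conv (Suc n) m \<le> 1" by (rule conv_le_1)
      also have "1 \<le> C0 * pmf p m" using C0[of m] False Suc.prems pm by (simp add: field_simps)
      also have "\<dots> \<le> a (Suc n) * pmf p m"
        using a0[of n] assms(3) pm by (intro mult_right_mono) (auto simp: a_Suc)
      finally show ?thesis .
    next
      case True
      have "{..m} = {..<K} \<union> {K..m}" using True M(4) by auto
      then have "conv (Suc n) m = (\<Sum>r<K. pmf p (m - r) * conv n r) + (\<Sum>r\<in>{K..m}. pmf p (m - r) * conv n r)"
        unfolding conv_Suc' by (simp add: sum.union_disjoint ivl_disj_int)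
      also have "(\<Sum>r<K. pmf p (m - r) * conv n r) \<le> (\<Sum>r<K. (1 + e) * pmf p m * 1)"
        by (intro sum_mono mult_mono low True conv_le_1) (use pm e conv_nonneg in auto)
      also have "\<dots> \<le> C0 * pmf p m"
      proof -
        have "(1 + e) * real K \<le> 2 * real K" using e by (intro mult_right_mono) auto
        then have "(1 + e) * real K \<le> C0" using C0_nonneg by linarith
        then have "((1 + e) * real K) * pmf p m \<le> C0 * pmf p m" by (rule mult_right_mono) simp
        then show ?thesis by (simp add: mult_ac)
      qed
      also have "(\<Sum>r\<in>{K..m}. pmf p (m - r) * conv n r) \<le> (\<Sum>r\<in>{K..m}. pmf p (m - r) * (a n * pmf p r))"
      proof (intro sum_mono mult_left_mono)
        fix r assume "r \<in> {K..m}"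
        \<comment> \<open>The induction hypothesis is available for r \<ge> 1 only, so r = 0 must
          fall among the terms below K. For K = 0 the sum in fact \<open>K\<close> would be empty,
          hence not above 1 - e.\<close>
        moreover have "K \<noteq> 0" using K e by (cases K) auto
        ultimately show "conv n r \<le> a n * pmf p r" by (intro Suc.IH) auto
      qed auto
      also have "\<dots> = a n * (\<Sum>r\<in>{K..m}. pmf p (m - r) * pmf p r)"
        by (simp add: sum_distrib_left mult_ac)
      also have "\<dots> \<le> a n * ((1 + \<epsilon>) * pmf p m)"
        by (intro mult_left_mono tail True a0)
      finally show ?thesis by (simp add: a_Suc algebra_simps)
    qed
  qed
  moreover have "a n \<le> (1 + C0 / \<epsilon>) * (1 + \<epsilon>) ^ n" for n
    using C0_nonneg assms(3) by (simp add: a_def)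
  ultimately have "conv n m \<le> (1 + C0 / \<epsilon>) * (1 + \<epsilon>) ^ n * pmf p m" if "m \<ge> 1" for n m
    using that by (meson mult_right_mono order.trans pmf_nonneg)
  moreover have "1 + C0 / \<epsilon> > 0" using C0_nonneg assms(3) by (simp add: add_pos_nonneg)
  ultimately show ?thesis using that by blast
qed

text \<open>Chaining: (III) with tolerance 1 costs a factor 2 whenever the argument grows by a
  factor of at most 1 + \<eta> / 2, and J such steps, J independent of k and m, cover the ratio
  D.\<close>

lemma irv_bounded_ratio:
  assumes irv
  obtains B M where "B > 0" "\<And>k m. M \<le> k \<Longrightarrow> k \<le> m \<Longrightarrow> real m \<le> D * real k \<Longrightarrow> pmf p m \<le> B * pmf p k"
proof -
  have "(1::real) > 0" by simp
  with assms obtain \<eta> where \<eta>: "\<eta> > 0" "\<forall>\<^sub>F m in sequentially. \<forall>k\<ge>1.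
     \<bar>real k / real m - 1\<bar> < \<eta> \<longrightarrow> \<bar>pmf p k / pmf p m - 1\<bar> \<le> 1"
    unfolding irv_def by blast
  \<comment> \<open>Rounding a step down to an integer loses less than 1 \<le> \<eta> / 4 * k, so
    each step still gains a factor 1 + \<eta> / 4.\<close>
  have "\<forall>\<^sub>F m in sequentially. 4 / \<eta> \<le> real m" by real_asymp
  from eventually_conj[OF \<eta>(2) eventually_conj[OF this eventually_ge_at_top[of 1]]]
  obtain M where M: "\<And>m k. m \<ge> M \<Longrightarrow> k \<ge> 1 \<Longrightarrow> \<bar>real k / real m - 1\<bar> < \<eta> \<Longrightarrow> \<bar>pmf p k / pmf p m - 1\<bar> \<le> 1"
    "\<And>m. m \<ge> M \<Longrightarrow> 4 / \<eta> \<le> real m" "\<And>m. m \<ge> M \<Longrightarrow> m \<ge> 1"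
    unfolding eventually_sequentially by metis
  have near: "pmf p m \<le> 2 * pmf p k" if "M \<le> k" "k \<le> m" "real m \<le> (1 + \<eta> / 2) * real k" for k m
  proof -
    have k: "k \<ge> 1" using M(3) that by blast
    have "\<bar>real m / real k - 1\<bar> = real m / real k - 1" using that k by (simp add: field_simps)
    also have "real m / real k \<le> 1 + \<eta> / 2" using that k by (simp add: field_simps)
    finally have "\<bar>real m / real k - 1\<bar> \<le> \<eta> / 2" by simp
    then have "\<bar>pmf p m / pmf p k - 1\<bar> \<le> 1" using \<eta>(1) k that by (intro M(1)) linarith+
    then show ?thesis using pmf_pos[OF k] by (simp add: abs_le_iff field_simps)
  qed
  have step: "pmf p m \<le> 2 ^ J * pmf p k"
    if "M \<le> k" "k \<le> m" "real m \<le> (1 + \<eta> / 4) ^ J * real k" for J k m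
    using that
  proof (induction J arbitrary: k)
    case 0
    then show ?case by simp
  next
    case (Suc J)
    define k' where "k' = nat \<lfloor>(1 + \<eta> / 2) * real k\<rfloor>"
    have nn: "(1 + \<eta> / 2) * real k \<ge> 0" using \<eta>(1) by simp
    have k': "real k' \<le> (1 + \<eta> / 2) * real k" "(1 + \<eta> / 2) * real k < real k' + 1"
      unfolding k'_def using nn by linarith+
    have "4 \<le> \<eta> * real k" using M(2)[OF Suc.prems(1)] \<eta>(1) by (simp add: field_simps)
    then have k'2: "(1 + \<eta> / 4) * real k \<le> real k'" using k'(2) by (simp add: algebra_simps)
    have "real k \<le> (1 + \<eta> / 4) * real k" using \<eta>(1) by (simp add: algebra_simps)
    with k'2 have kk: "k \<le> k'" by linarith
    show ?case
    proof (cases "m \<le> k'")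
      case True
      have "pmf p m \<le> 2 * pmf p k"
        by (rule near) (use Suc.prems True k' in auto)
      also have "\<dots> \<le> 2 ^ Suc J * pmf p k"
        using self_le_power[of "2::real" "Suc J"] by (intro mult_right_mono) auto
      finally show ?thesis .
    next
      case False
      have "real m \<le> (1 + \<eta> / 4) ^ J * ((1 + \<eta> / 4) * real k)"
        using Suc.prems by (simp add: mult_ac)
      also have "\<dots> \<le> (1 + \<eta> / 4) ^ J * real k'"
        using k'2 \<eta>(1) by (intro mult_left_mono) auto
      finally have "pmf p m \<le> 2 ^ J * pmf p k'"
        using Suc.prems kk False by (intro Suc.IH) auto
      also have "\<dots> \<le> 2 ^ J * (2 * pmf p k)"
        using near[of k k'] Suc.prems kk k' by (intro mult_left_mono) auto
      finally show ?thesis by simp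
    qed
  qed
  obtain J where J: "D < (1 + \<eta> / 4) ^ J"
    using real_arch_pow[of "1 + \<eta> / 4" D] \<eta>(1) by auto
  show ?thesis
  proof (rule that[of "2 ^ J" M])
    fix k m assume km: "M \<le> k" "k \<le> m" "real m \<le> D * real k"
    have "D * real k \<le> (1 + \<eta> / 4) ^ J * real k" using J by (intro mult_right_mono) auto
    with km show "pmf p m \<le> 2 ^ J * pmf p k" by (intro step) auto
  qed auto
qed

end


section \<open>Random number of jumps\<close>

lemma pmf_nat_sums:
  fixes p :: "nat pmf"
  shows "pmf p sums 1"
proof -
  have "(\<lambda>n. measure_pmf.prob p {n}) sums measure_pmf.prob p (\<Union>n. {n})"
    by (rule measure_pmf.finite_measure_UNION) (auto simp: disjoint_family_on_def)
  then show ?thesis by (simp add: pmf.rep_eq)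
qed

lemma summable_pmf_bounded:
  fixes p :: "nat pmf"
  assumes "\<And>n. \<bar>f n\<bar> \<le> B"
  shows "summable (\<lambda>n. pmf p n * f n)"
proof (rule summable_comparison_test'[of "\<lambda>n. pmf p n * B" 0])
  show "summable (\<lambda>n. pmf p n * B)" using sums_mult2[OF pmf_nat_sums] by (rule sums_summable)
  show "norm (pmf p n * f n) \<le> pmf p n * B" for n
    using assms[of n] by (simp add: abs_mult mult_left_mono)
qed

lemma near_one_mult:
  fixes u v :: real
  assumes "\<bar>u - 1\<bar> \<le> a" "\<bar>v - 1\<bar> \<le> b"
  shows "\<bar>u * v - 1\<bar> \<le> a + b + a * b"
proof -
  have "\<bar>u * v - 1\<bar> = \<bar>(u - 1) + (v - 1) + (u - 1) * (v - 1)\<bar>" by (simp add: algebra_simps)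
  also have "\<dots> \<le> \<bar>u - 1\<bar> + \<bar>v - 1\<bar> + \<bar>u - 1\<bar> * \<bar>v - 1\<bar>"
    unfolding abs_mult[symmetric] by linarith
  also have "\<dots> \<le> a + b + a * b" using assms by (intro add_mono mult_mono) auto
  finally show ?thesis .
qed

lemma near_one_divide_iff:
  fixes a b :: real
  assumes "b > 0"
  shows "\<bar>a / b - 1\<bar> \<le> e \<longleftrightarrow> (1 - e) * b \<le> a \<and> a \<le> (1 + e) * b"
proof -
  have "\<bar>a / b - 1\<bar> \<le> e \<longleftrightarrow> 1 - e \<le> a / b \<and> a / b \<le> 1 + e" by linarith
  then show ?thesis using assms by (simp add: pos_le_divide_eq pos_divide_le_eq)
qed

text \<open>Here \<open>y\<close> plays the role of \<^const>\<open>jump_threshold\<close>; the last two assumptions are all that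
  the argument uses about it: above \<open>y t\<close> the excess over the mean is of order \<open>t\<close>, and (II)
  applies to every number of summands close to \<open>t\<close>.\<close>

locale one_jump = positive_law +
  fixes \<mu> :: real and x :: "nat \<Rightarrow> real" and y :: "real \<Rightarrow> real" and c d :: real
  assumes integrable: "integrable p real"
    and mean: "\<mu> = measure_pmf.expectation p real"
    and subexp: "(\<lambda>m. conv 2 m / (2 * pmf p m)) \<longlonglongrightarrow> 1"
    and irv: irv
    and jump: "\<And>\<epsilon>. \<epsilon> > 0 \<Longrightarrow> \<forall>\<^sub>F n in sequentially. \<forall>m::nat. real n * \<mu> + x n \<le> real m \<longrightarrow>
        \<bar>conv n m / (real n * pmf p (nat \<lceil>real m - real n * \<mu>\<rceil>)) - 1\<bar> \<le> \<epsilon>"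
    and c_pos: "c > 0" and d_pos: "d > 0"
    and threshold_linear: "\<forall>\<^sub>F t in at_top. (\<mu> + c) * t \<le> y t"
    and threshold_jump: "\<forall>\<^sub>F t in at_top. \<forall>n::nat. \<bar>real n - t\<bar> \<le> d * t \<longrightarrow> real n * \<mu> + x n \<le> y t"
begin

section \<open>Numbers of jumps near the mean and away from it\<close>

definition excess :: "real \<Rightarrow> nat \<Rightarrow> nat" where
  "excess t m = nat \<lceil>real m - \<mu> * t\<rceil>"

text \<open>The expectation of f N for a Poisson N with mean t, kept as a series so that bounds can
  be proved term by term in n. Its value is meaningful only for summable series, hence the
  accompanying summability facts.\<close>

definition mixture :: "real \<Rightarrow> (nat \<Rightarrow> real) \<Rightarrow> real" where
  "mixture t f = (\<Sum>n. pmf (poisson_pmf t) n * f n)"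

lemma mean_nonneg: "\<mu> \<ge> 0"
  unfolding mean by simp

text \<open>Above the line (\<mu> + c) * t the excess is at least c * t, so \<open>nat\<close> cuts
  nothing off and \<mu> * t is at most \<mu> / c times the excess. The last bound is the ratio with
  which \<open>irv_bounded_ratio\<close> compares p m to p at the excess.\<close>

lemma excess_bounds:
  assumes "t > 0" "(\<mu> + c) * t \<le> real m"
  shows "real m - \<mu> * t \<le> real (excess t m)" "real (excess t m) \<le> real m - \<mu> * t + 1"
    "c * t \<le> real (excess t m)" "excess t m \<ge> 1" "excess t m \<le> m" "real m \<le> (1 + \<mu> / c) * real (excess t m)"
proof -
  have ct: "c * t > 0" using c_pos assms by simp
  have mt: "c * t \<le> real m - \<mu> * t" using assms(2) by (simp add: algebra_simps)
  show 1: "real m - \<mu> * t \<le> real (excess t m)" "real (excess t m) \<le> real m - \<mu> * t + 1"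
    unfolding excess_def using mt ct by linarith+
  then show 3: "c * t \<le> real (excess t m)" using mt by linarith
  then show "excess t m \<ge> 1" using ct by (cases "excess t m") auto
  have "0 \<le> \<mu> * t" using mean_nonneg assms(1) by simp
  then have "\<lceil>real m - \<mu> * t\<rceil> \<le> int m" by (simp add: ceiling_le_iff)
  then show "excess t m \<le> m" unfolding excess_def nat_le_iff .
  have "\<mu> * t = \<mu> / c * (c * t)" using c_pos by simp
  also have "\<dots> \<le> \<mu> / c * real (excess t m)"
    using 3 mean_nonneg c_pos by (intro mult_left_mono) auto
  finally show "real m \<le> (1 + \<mu> / c) * real (excess t m)" using 1 by (simp add: algebra_simps)
qed

text \<open>Serves twice: for m - n * \<mu> rounded up, with n near t, and for m minus the sum of a
  typical configuration. The + 1 in the tolerance pays for rounding.\<close>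

lemma pmf_near_excess:
  assumes "\<epsilon> > 0"
  obtains \<delta> where "\<delta> > 0" "\<forall>\<^sub>F t in at_top. \<forall>m k. (\<mu> + c) * t \<le> real m \<longrightarrow>
     \<bar>real k - (real m - \<mu> * t)\<bar> \<le> \<delta> * t + 1 \<longrightarrow> k \<ge> 1 \<and> \<bar>pmf p k / pmf p (excess t m) - 1\<bar> \<le> \<epsilon>"
proof -
  from irv assms obtain \<eta> M where \<eta>: "\<eta> > 0" "\<And>m k. m \<ge> M \<Longrightarrow> k \<ge> 1 \<Longrightarrow>
     \<bar>real k / real m - 1\<bar> < \<eta> \<Longrightarrow> \<bar>pmf p k / pmf p m - 1\<bar> \<le> \<epsilon>"
    unfolding irv_def eventually_sequentially by metis
  \<comment> \<open>c / 2 leaves k at least c * t / 2 - 1, which is positive for large t; c * \<eta>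
    / 4 keeps k within relative distance \<eta> of the excess, roundings included.\<close>
  define \<delta> where "\<delta> = min (c / 2) (c * \<eta> / 4)"
  have \<delta>: "\<delta> > 0" "\<delta> \<le> c / 2" "\<delta> \<le> c * \<eta> / 4" using c_pos \<eta>(1) by (auto simp: \<delta>_def)
  have "\<forall>\<^sub>F t in at_top. 4 / c \<le> t \<and> 4 / (c * \<eta>) \<le> t \<and> real M / c \<le> t \<and> 0 < t"
    by (intro eventually_conj eventually_ge_at_top eventually_gt_at_top)
  then have "\<forall>\<^sub>F t in at_top. \<forall>m k. (\<mu> + c) * t \<le> real m \<longrightarrow>
     \<bar>real k - (real m - \<mu> * t)\<bar> \<le> \<delta> * t + 1 \<longrightarrow> k \<ge> 1 \<and> \<bar>pmf p k / pmf p (excess t m) - 1\<bar> \<le> \<epsilon>"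
  proof (eventually_elim, intro allI impI conjI)
    fix t m k
    assume t: "4 / c \<le> t \<and> 4 / (c * \<eta>) \<le> t \<and> real M / c \<le> t \<and> 0 < t"
      and m: "(\<mu> + c) * t \<le> real m" and k: "\<bar>real k - (real m - \<mu> * t)\<bar> \<le> \<delta> * t + 1"
    have t': "4 \<le> c * t" "4 \<le> c * \<eta> * t" "real M \<le> c * t" "0 < t"
      using t c_pos \<eta>(1) by (auto simp: field_simps)
    have d2: "\<delta> * t \<le> c * t / 2" "\<delta> * t \<le> c * \<eta> * t / 4"
      using mult_right_mono[OF \<delta>(2), of t] mult_right_mono[OF \<delta>(3), of t] t' by auto
    note ex = excess_bounds[OF t'(4) m]
    have "\<mu> * t + c * t \<le> real m" using m by (simp add: distrib_right)
    then have "real k \<ge> 1" using k d2 t' by linarith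
    then show k1: "k \<ge> 1" by simp
    have "\<bar>real k - real (excess t m)\<bar> \<le> \<delta> * t + 2" using k ex(1,2) by (auto simp: abs_le_iff)
    also have "\<dots> < c * \<eta> * t" using d2 t' by linarith
    also have "\<dots> \<le> \<eta> * real (excess t m)"
      using mult_left_mono[OF ex(3), of \<eta>] \<eta>(1) by (simp add: mult_ac)
    finally have "\<bar>real k / real (excess t m) - 1\<bar> < \<eta>"
      using ex(4) by (simp add: abs_less_iff field_simps)
    moreover have "excess t m \<ge> M" using t' ex(3) by linarith
    ultimately show "\<bar>pmf p k / pmf p (excess t m) - 1\<bar> \<le> \<epsilon>"
      using \<eta>(2) k1 by blast
  qed
  with \<delta>(1) show ?thesis using that by blast
qed

text \<open>With k the excess computed from n jumps, the quotient is the product of conv n m / (n *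
  p k), p k / p (excess t m) and n / t: (II) controls the first factor, (III) the second, the window
  the third.\<close>

lemma conv_central_range:
  assumes "\<epsilon> > 0"
  obtains \<delta> where "0 < \<delta>" "\<delta> < 1" "\<forall>\<^sub>F t in at_top. \<forall>m n. y t \<le> real m \<longrightarrow> \<bar>real n - t\<bar> \<le> \<delta> * t \<longrightarrow>
     \<bar>conv n m / (t * pmf p (excess t m)) - 1\<bar> \<le> \<epsilon>"
proof -
  define e where "e = min \<epsilon> 1 / 8"
  have e: "e > 0" "e \<le> 1 / 8" "8 * e \<le> \<epsilon>" using assms by (auto simp: e_def)
  obtain \<delta>0 where \<delta>0: "\<delta>0 > 0" "\<forall>\<^sub>F t in at_top. \<forall>m k. (\<mu> + c) * t \<le> real m \<longrightarrow>
     \<bar>real k - (real m - \<mu> * t)\<bar> \<le> \<delta>0 * t + 1 \<longrightarrow> k \<ge> 1 \<and> \<bar>pmf p k / pmf p (excess t m) - 1\<bar> \<le> e"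
    using pmf_near_excess[OF e(1)] by blast
  \<comment> \<open>In this order the bounds serve n / t, the applicability of (II), the distance
    from n * \<mu> to \<mu> * t in (III), and the nonnegativity of m - n * \<mu>. The denominator
    \<mu> + 1 is positive even for \<mu> = 0.\<close>
  define \<delta> where "\<delta> = min (min e d) (min (\<delta>0 / (\<mu> + 1)) (c / (\<mu> + 1)))"
  have \<delta>: "\<delta> > 0" "\<delta> \<le> e" "\<delta> \<le> d" "\<delta> \<le> \<delta>0 / (\<mu> + 1)" "\<delta> \<le> c / (\<mu> + 1)"
    using e d_pos \<delta>0 mean_nonneg c_pos by (auto simp: \<delta>_def)
  have \<delta>\<mu>: "\<delta> * \<mu> \<le> \<delta>0" "\<delta> * \<mu> \<le> c"
    using \<delta> mean_nonneg by (simp_all add: field_simps)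
  obtain n0 where n0: "\<And>n m. n \<ge> n0 \<Longrightarrow> real n * \<mu> + x n \<le> real m \<Longrightarrow>
        \<bar>conv n m / (real n * pmf p (nat \<lceil>real m - real n * \<mu>\<rceil>)) - 1\<bar> \<le> e"
    using jump[OF e(1)] unfolding eventually_sequentially by blast
  have "\<forall>\<^sub>F t in at_top. 2 * real n0 \<le> t \<and> 0 < t"
    by (intro eventually_conj eventually_ge_at_top eventually_gt_at_top)
  with \<delta>0(2) threshold_linear threshold_jump
  have "\<forall>\<^sub>F t in at_top. \<forall>m n. y t \<le> real m \<longrightarrow> \<bar>real n - t\<bar> \<le> \<delta> * t \<longrightarrow>
     \<bar>conv n m / (t * pmf p (excess t m)) - 1\<bar> \<le> \<epsilon>"
  proof (eventually_elim, intro allI impI)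
    fix t m n
    assume near: "\<forall>m k. (\<mu> + c) * t \<le> real m \<longrightarrow>
        \<bar>real k - (real m - \<mu> * t)\<bar> \<le> \<delta>0 * t + 1 \<longrightarrow> k \<ge> 1 \<and> \<bar>pmf p k / pmf p (excess t m) - 1\<bar> \<le> e"
      and lin: "(\<mu> + c) * t \<le> y t"
      and jmp: "\<forall>n. \<bar>real n - t\<bar> \<le> d * t \<longrightarrow> real n * \<mu> + x n \<le> y t"
      and t: "2 * real n0 \<le> t \<and> 0 < t" and m: "y t \<le> real m" and n: "\<bar>real n - t\<bar> \<le> \<delta> * t"
    have m': "(\<mu> + c) * t \<le> real m" using lin m by linarith
    have "\<delta> * t \<le> (1 / 8) * t" using \<delta>(2) e(2) t by (intro mult_right_mono) auto
    then have "real n \<ge> t * 7 / 8" using n by linarith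
    then have npos: "n \<ge> n0" "real n > 0" using t by linarith+
    have "\<delta> * t \<le> d * t" using \<delta>(3) t by (intro mult_right_mono) auto
    then have "real n * \<mu> + x n \<le> real m" using jmp n m by (smt (verit))
    define k where "k = nat \<lceil>real m - real n * \<mu>\<rceil>"
    have 1: "\<bar>conv n m / (real n * pmf p k) - 1\<bar> \<le> e"
      unfolding k_def using n0 npos \<open>real n * \<mu> + x n \<le> real m\<close> by blast
    have "\<bar>real n * \<mu> - \<mu> * t\<bar> = \<mu> * \<bar>real n - t\<bar>"
      using mean_nonneg by (simp add: abs_mult flip: right_diff_distrib mult.commute[of \<mu>])
    also have "\<dots> \<le> \<mu> * (\<delta> * t)" using n mean_nonneg by (intro mult_left_mono)
    finally have nm: "\<bar>real n * \<mu> - \<mu> * t\<bar> \<le> (\<delta> * \<mu>) * t" by (simp add: mult_ac)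
    have nmc: "(\<delta> * \<mu>) * t \<le> c * t" "(\<delta> * \<mu>) * t \<le> \<delta>0 * t"
      using \<delta>\<mu> t by (auto intro!: mult_right_mono)
    have "real m - real n * \<mu> \<ge> 0" using nm nmc m' by (simp add: algebra_simps abs_le_iff)
    then have "real m - real n * \<mu> \<le> real k" "real k \<le> real m - real n * \<mu> + 1"
      unfolding k_def by linarith+
    then have "\<bar>real k - (real m - \<mu> * t)\<bar> \<le> \<delta>0 * t + 1"
      using nm nmc by (auto simp: abs_le_iff)
    with near m' have 2: "k \<ge> 1" "\<bar>pmf p k / pmf p (excess t m) - 1\<bar> \<le> e" by blast+
    have 3: "\<bar>real n / t - 1\<bar> \<le> e"
    proof -
      have tp: "t > 0" using t by (rule conjunct2)
      have eq: "real n / t - 1 = (real n - t) / t" using tp by (simp add: diff_divide_distrib)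
      have "\<bar>real n / t - 1\<bar> = \<bar>real n - t\<bar> / t"
        unfolding eq abs_divide using tp by simp
      also have "\<dots> \<le> \<delta>" unfolding pos_divide_le_eq[OF tp] by (rule n)
      finally show ?thesis using \<delta>(2) by linarith
    qed
    have "conv n m / (t * pmf p (excess t m)) =
        conv n m / (real n * pmf p k) * (pmf p k / pmf p (excess t m)) * (real n / t)"
      using pmf_pos[OF 2(1)] npos by (simp add: field_simps)
    also have "\<bar>\<dots> - 1\<bar> \<le> (e + e + e * e) + e + (e + e + e * e) * e"
      by (intro near_one_mult 1 2 3)
    finally have *: "\<bar>conv n m / (t * pmf p (excess t m)) - 1\<bar> \<le> (e + e + e * e) + e + (e + e + e * e) * e" .
    define r where "r = e + e + e * e"
    have "e * e \<le> e * 1" using e by (intro mult_left_mono) auto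
    then have r: "r \<le> 3 * e" by (simp add: r_def)
    then have "r * e \<le> (3 * e) * 1" using e by (intro mult_mono) auto
    with * r show "\<bar>conv n m / (t * pmf p (excess t m)) - 1\<bar> \<le> \<epsilon>"
      using e unfolding r_def[symmetric] by linarith
  qed
  with \<delta> e that show ?thesis by force
qed

text \<open>For each n, \<open>conv n m\<close> lies between two affine functions of
  \<open>U u t n\<close>, the weight u ^ n restricted to n outside the window. Averaging over the
  Poisson law turns \<open>U\<close> into a quantity tending to 0, so the series never has to be
  split.\<close>

lemma mixture_conv_asymp:
  assumes "\<epsilon> > 0"
  shows "\<forall>\<^sub>F t in at_top. \<forall>m. y t \<le> real m \<longrightarrow>
    \<bar>mixture t (\<lambda>n. conv n m) / (t * pmf p (excess t m)) - 1\<bar> \<le> \<epsilon>"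
proof -
  define e where "e = min \<epsilon> 1 / 2"
  have e: "e > 0" "e \<le> 1 / 2" "2 * e \<le> \<epsilon>" using assms by (auto simp: e_def)
  obtain \<delta> where \<delta>: "0 < \<delta>" "\<delta> < 1" "\<forall>\<^sub>F t in at_top. \<forall>m n. y t \<le> real m \<longrightarrow> \<bar>real n - t\<bar> \<le> \<delta> * t \<longrightarrow>
     \<bar>conv n m / (t * pmf p (excess t m)) - 1\<bar> \<le> e"
    using conv_central_range[OF e(1)] by blast
  define U where "U u t n = u ^ n * of_bool (\<delta> * t < \<bar>real n - t\<bar>)" for u t :: real and n
  obtain u where u: "u > 1" "\<And>t. t > 0 \<Longrightarrow> summable (\<lambda>n. pmf (poisson_pmf t) n * U u t n)"
      "((\<lambda>t. mixture t (U u t)) \<longlongrightarrow> 0) at_top"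
    unfolding U_def mixture_def using poisson_tilted_tail[OF \<delta>(1,2)] by blast
  have "u - 1 > 0" using u by simp
  from kesten_bound[OF subexp irv this]
  obtain C where C: "C > 0" "\<And>n m. m \<ge> 1 \<Longrightarrow> conv n m \<le> C * u ^ n * pmf p m"
    by (metis add.commute diff_add_cancel)
  obtain B M where B: "B > 0" "\<And>k m. M \<le> k \<Longrightarrow> k \<le> m \<Longrightarrow> real m \<le> (1 + \<mu> / c) * real k \<Longrightarrow>
      pmf p m \<le> B * pmf p k"
    using irv_bounded_ratio[OF irv, of "1 + \<mu> / c"] by blast
  \<comment> \<open>The first entry serves the lower bound, the second the upper one: Kesten's error
    C * B * P carries no factor t, but t \<ge> 1 lets e * t * P absorb it.\<close>
  have "min e (e / (C * B)) > 0" using e B C by auto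
  from order_tendstoD(2)[OF u(3) this]
  have T: "\<forall>\<^sub>F t in at_top. mixture t (U u t) < min e (e / (C * B))" .
  have "\<forall>\<^sub>F t in at_top. 1 \<le> t \<and> real M / c \<le> t"
    by (intro eventually_conj eventually_ge_at_top)
  with T \<delta>(3) threshold_linear show ?thesis
  proof (eventually_elim, intro allI impI)
    fix t m
    assume T: "mixture t (U u t) < min e (e / (C * B))"
      and cen: "\<forall>m n. y t \<le> real m \<longrightarrow> \<bar>real n - t\<bar> \<le> \<delta> * t \<longrightarrow>
        \<bar>conv n m / (t * pmf p (excess t m)) - 1\<bar> \<le> e"
      and lin: "(\<mu> + c) * t \<le> y t" and t: "1 \<le> t \<and> real M / c \<le> t" and m: "y t \<le> real m"
    have t0: "t > 0" using t by simp
    have m': "(\<mu> + c) * t \<le> real m" using lin m by linarith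
    note ex = excess_bounds[OF t0 m']
    define P where "P = pmf p (excess t m)"
    have P: "P > 0" using pmf_pos ex(4) by (simp add: P_def)
    have m1: "m \<ge> 1" using ex by linarith
    have "M \<le> excess t m" using ex(3) t c_pos by (simp add: field_simps)
    then have pm: "pmf p m \<le> B * P" unfolding P_def by (intro B(2) ex)
    have U0: "U u t n \<ge> 0" for n using u(1) by (simp add: U_def)
    have U1: "U u t n \<ge> 1" if "\<delta> * t < \<bar>real n - t\<bar>" for n using u(1) that by (simp add: U_def)
    let ?p = "pmf (poisson_pmf t)"
    have cen': "(1 - e) * (t * P) \<le> conv n m" "conv n m \<le> (1 + e) * (t * P)"
      if "\<not> \<delta> * t < \<bar>real n - t\<bar>" for n
    proof -
      have "\<bar>conv n m / (t * P) - 1\<bar> \<le> e" using cen m that by (auto simp: P_def)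
      moreover have "t * P > 0" using t0 P by simp
      ultimately show "(1 - e) * (t * P) \<le> conv n m" "conv n m \<le> (1 + e) * (t * P)"
        using near_one_divide_iff by blast+
    qed
    have up: "conv n m \<le> (1 + e) * (t * P) + C * B * P * U u t n" for n
    proof (cases "\<delta> * t < \<bar>real n - t\<bar>")
      case True
      have "conv n m \<le> C * u ^ n * pmf p m" by (rule C(2)[OF m1])
      also have "\<dots> \<le> C * u ^ n * (B * P)" using C u pm by (intro mult_left_mono) auto
      also have "\<dots> = C * B * P * U u t n" using True by (simp add: U_def)
      finally show ?thesis using e t0 P by (smt (verit) mult_nonneg_nonneg)
    next
      case False
      then show ?thesis using cen'[of n] U0[of n] C B P by (smt (verit) mult_nonneg_nonneg)
    qed
    \<comment> \<open>Outside the window \<open>U\<close> is at least 1, so the left side is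
      nonpositive and no lower estimate of \<open>conv n m\<close> is needed.\<close>
    have low: "(1 - e) * (t * P) * (1 - U u t n) \<le> conv n m" for n
    proof (cases "\<delta> * t < \<bar>real n - t\<bar>")
      case True
      then have "(1 - e) * (t * P) * (1 - U u t n) \<le> 0"
        using e t0 P U1[OF True] by (intro mult_nonneg_nonpos) auto
      also have "\<dots> \<le> conv n m" by (rule conv_nonneg)
      finally show ?thesis .
    next
      case False
      then show ?thesis using cen'[of n] by (simp add: U_def)
    qed
    have S: "summable (\<lambda>n. ?p n * conv n m)"
      by (rule summable_pmf_bounded[of _ 1]) (use conv_nonneg conv_le_1 in \<open>auto simp: abs_le_iff intro: order.trans[OF _ conv_nonneg]\<close>)
    note Us = summable_sums[OF u(2)[OF t0], folded mixture_def]
    have "(\<lambda>n. ?p n * ((1 + e) * (t * P) + C * B * P * U u t n)) sums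
        (1 * ((1 + e) * (t * P)) + C * B * P * mixture t (U u t))"
      using sums_add[OF sums_mult2[OF pmf_nat_sums[of "poisson_pmf t"], of "(1 + e) * (t * P)"] sums_mult[OF Us, of "C * B * P"]]
      by (simp add: algebra_simps)
    from sums_le[OF mult_left_mono[OF up pmf_nonneg] summable_sums[OF S] this]
    have "mixture t (\<lambda>n. conv n m) \<le> 1 * ((1 + e) * (t * P)) + C * B * P * mixture t (U u t)"
      by (simp only: mixture_def)
    also have "C * B * P * mixture t (U u t) \<le> e * (t * P)"
    proof -
      have "(C * B) * mixture t (U u t) \<le> e" using T C B by (simp add: field_simps)
      then have "(C * B) * mixture t (U u t) \<le> e * t" using mult_left_mono[of 1 t e] t e by linarith
      from mult_right_mono[OF this, of P] P show ?thesis by (simp add: mult_ac)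
    qed
    finally have 1: "mixture t (\<lambda>n. conv n m) \<le> (1 + 2 * e) * (t * P)" by (simp add: algebra_simps)
    have "(\<lambda>n. ?p n * ((1 - e) * (t * P) * (1 - U u t n))) sums
        ((1 - e) * (t * P) * (1 - mixture t (U u t)))"
      using sums_mult[OF sums_diff[OF pmf_nat_sums[of "poisson_pmf t"] Us], of "(1 - e) * (t * P)"]
      by (simp add: algebra_simps)
    from sums_le[OF mult_left_mono[OF low pmf_nonneg] this summable_sums[OF S]]
    have "(1 - e) * (t * P) * (1 - mixture t (U u t)) \<le> mixture t (\<lambda>n. conv n m)"
      by (simp only: mixture_def)
    moreover have "(1 - e) * (t * P) * (1 - e) \<le> (1 - e) * (t * P) * (1 - mixture t (U u t))"
      using T e t0 P by (intro mult_left_mono) auto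
    moreover have "(1 - 2 * e) * (t * P) \<le> (1 - e) * (t * P) * (1 - e)"
      using e t0 P by (simp add: algebra_simps)
    ultimately have 2: "(1 - 2 * e) * (t * P) \<le> mixture t (\<lambda>n. conv n m)" by linarith
    have tP: "t * P > 0" using t0 P by simp
    have "\<bar>mixture t (\<lambda>n. conv n m) / (t * P) - 1\<bar> \<le> 2 * e"
      using 1 2 near_one_divide_iff[OF tP] by blast
    then show "\<bar>mixture t (\<lambda>n. conv n m) / (t * pmf p (excess t m)) - 1\<bar> \<le> \<epsilon>"
      using e by (simp add: P_def)
  qed
qed

end


section \<open>The law of the bulk\<close>

text \<open>Strictness makes the inserted entry the only maximum, so its position can be read off.
  With a tie, insertions at different positions could give the same sequence.\<close>

lemma bulk_insert:
  assumes i: "i \<le> length a" and v: "\<And>z. z \<in> set a \<Longrightarrow> z < v"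
  shows "first_max (take i a @ v # drop i a) = i" "bulk (take i a @ v # drop i a) = a"
proof -
  let ?xs = "take i a @ v # drop i a"
  have set: "set ?xs = insert v (set a)"
  proof -
    have "set (take i a) \<union> set (drop i a) = set a" by (metis append_take_drop_id set_append)
    then show ?thesis by simp
  qed
  have max: "Max (set ?xs) = v"
    unfolding set by (rule Max_eqI) (use v in \<open>auto intro: less_imp_le\<close>)
  show fm: "first_max ?xs = i"
    unfolding first_max_def max
  proof (rule Least_equality)
    show "i < length ?xs \<and> ?xs ! i = v" using i by (simp add: nth_append)
  next
    fix j assume j: "j < length ?xs \<and> ?xs ! j = v"
    show "i \<le> j"
    proof (rule ccontr)
      assume "\<not> i \<le> j"
      then have "?xs ! j = a ! j" "a ! j \<in> set a" using i by (auto simp: nth_append)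
      with j v show False by fastforce
    qed
  qed
  show "bulk ?xs = a" unfolding bulk_def fm using i by simp
qed

text \<open>The maximal entry can have been removed from any of the \<open>k + 1\<close> positions.\<close>

lemma prob_bulk_ge:
  assumes fin: "finite B" and B: "\<And>a. a \<in> B \<Longrightarrow> length a = k" "\<And>a z. a \<in> B \<Longrightarrow> z \<in> set a \<Longrightarrow> z + sum_list a < m"
  shows "real (Suc k) * (\<Sum>a\<in>B. pmf (replicate_pmf k p) a * pmf p (m - sum_list a)) \<le>
    measure_pmf.prob (replicate_pmf (Suc k) p) {xs. bulk xs \<in> B \<and> sum_list xs = m}"
proof -
  define ins where "ins = (\<lambda>(i, a). take i a @ (m - sum_list a) # drop i a)"
  let ?D = "{..k} \<times> B"
  have big: "z < m - sum_list a" if "a \<in> B" "z \<in> set a" for a z using B(2)[OF that] by linarith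
  have ins: "first_max (ins (i, a)) = i" "bulk (ins (i, a)) = a" if "i \<le> k" "a \<in> B" for i a
    unfolding ins_def prod.case by (rule bulk_insert; use that B(1) big in force)+
  \<comment> \<open>\<open>first_max\<close> and \<open>bulk\<close> recover i and a from the
    inserted list, so together they invert \<open>ins\<close>.\<close>
  have inj: "inj_on ins ?D"
    by (rule inj_onI) (metis SigmaE atMost_iff ins)
  have pmf: "pmf (replicate_pmf (Suc k) p) (ins (i, a)) = pmf (replicate_pmf k p) a * pmf p (m - sum_list a)"
    if "i \<le> k" "a \<in> B" for i a
  proof -
    have "prod_list (map (pmf p) (take i a)) * prod_list (map (pmf p) (drop i a)) = prod_list (map (pmf p) a)"
      by (metis append_take_drop_id map_append prod_list.append)
    then show ?thesis using that B(1)[OF that(2)]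
      unfolding pmf_replicate by (simp add: ins_def mult_ac)
  qed
  have sum: "sum_list (ins (i, a)) = m" if "a \<in> B" for i a
  proof -
    have "sum_list a \<le> m" using B(2)[OF that, of "hd a"] by (cases a) auto
    moreover have "sum_list (take i a) + sum_list (drop i a) = sum_list a"
      by (metis append_take_drop_id sum_list_append)
    ultimately show ?thesis by (simp add: ins_def)
  qed
  have "real (Suc k) * (\<Sum>a\<in>B. pmf (replicate_pmf k p) a * pmf p (m - sum_list a)) =
      (\<Sum>i\<le>k. \<Sum>a\<in>B. pmf (replicate_pmf (Suc k) p) (ins (i, a)))"
    using pmf by (simp del: replicate_pmf.simps)
  also have "\<dots> = (\<Sum>d\<in>?D. pmf (replicate_pmf (Suc k) p) (ins d))"
    by (simp add: sum.cartesian_product case_prod_unfold del: replicate_pmf.simps)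
  also have "\<dots> = measure_pmf.prob (replicate_pmf (Suc k) p) (ins ` ?D)"
    using fin by (simp add: measure_measure_pmf_finite sum.reindex[OF inj] del: replicate_pmf.simps)
  also have "\<dots> \<le> measure_pmf.prob (replicate_pmf (Suc k) p) {xs. bulk xs \<in> B \<and> sum_list xs = m}"
    by (rule measure_pmf.finite_measure_mono) (auto simp: ins sum simp del: replicate_pmf.simps)
  finally show ?thesis .
qed

context one_jump
begin

text \<open>A joint probability; the division by the probability of the conditioning event takes
  place in \<open>bulk_prob_asymp\<close>.\<close>

definition bulk_prob :: "real \<Rightarrow> nat \<Rightarrow> nat list set \<Rightarrow> real" where
  "bulk_prob t m A = mixture t (\<lambda>n. measure_pmf.prob (replicate_pmf n p) {xs. bulk xs \<in> A \<and> sum_list xs = m})"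

text \<open>For n = 0 truncated subtraction gives the empty list, as for n = 1. It lies outside
  \<open>pos_seqs\<close>, which matches the convention for N \<le> 1.\<close>

definition free_prob :: "real \<Rightarrow> nat list set \<Rightarrow> real" where
  "free_prob t A = mixture t (\<lambda>n. measure_pmf.prob (replicate_pmf (n - 1) p) A)"

lemma summable_mixture_prob:
  "summable (\<lambda>n. pmf (poisson_pmf t) n * measure_pmf.prob (F n) (A n))"
  by (rule summable_pmf_bounded[of _ 1]) (simp add: measure_pmf.prob_le_1)

lemma mixture_prob_le_1: "mixture t (\<lambda>n. measure_pmf.prob (F n) (A n)) \<le> 1"
proof -
  have "mixture t (\<lambda>n. measure_pmf.prob (F n) (A n)) \<le> (\<Sum>n. pmf (poisson_pmf t) n)"
    unfolding mixture_def
    by (rule suminf_le[OF _ summable_mixture_prob sums_summable[OF pmf_nat_sums]])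
      (simp add: mult_left_le measure_pmf.prob_le_1)
  then show ?thesis using sums_unique[OF pmf_nat_sums, of "poisson_pmf t"] by simp
qed

lemma mixture_prob_nonneg: "0 \<le> mixture t (\<lambda>n. measure_pmf.prob (F n) (A n))"
  unfolding mixture_def by (rule suminf_nonneg[OF summable_mixture_prob]) simp

text \<open>By the weak law, all but a small part of the free configurations of \<open>n - 1\<close> entries leave a
  deficit \<open>m - sum\<close> close to \<open>m - \<mu> t\<close> and larger than every entry, so adding one jump of that size
  produces a sequence whose bulk is the given configuration.\<close>

lemma bulk_prob_lower:
  assumes "0 < \<epsilon>" "\<epsilon> \<le> 1"
  shows "\<forall>\<^sub>F t in at_top. \<forall>m A. y t \<le> real m \<longrightarrow>
    (free_prob t A - \<epsilon>) * (1 - \<epsilon>) * (t * pmf p (excess t m)) \<le> bulk_prob t m A"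
proof -
  \<comment> \<open>Fits both losses: (1 - e)^2 \<ge> 1 - \<epsilon>, and atypical configurations
    and atypical n cost e each.\<close>
  define e where "e = \<epsilon> / 2"
  have e: "e > 0" "e \<le> 1 / 2" using assms by (auto simp: e_def)
  obtain \<delta>0 where \<delta>0: "\<delta>0 > 0" "\<forall>\<^sub>F t in at_top. \<forall>m k. (\<mu> + c) * t \<le> real m \<longrightarrow>
     \<bar>real k - (real m - \<mu> * t)\<bar> \<le> \<delta>0 * t + 1 \<longrightarrow> k \<ge> 1 \<and> \<bar>pmf p k / pmf p (excess t m) - 1\<bar> \<le> e"
    using pmf_near_excess[OF e(1)] by blast
  define \<delta>1 where "\<delta>1 = min \<delta>0 (c / 2)"
  have \<delta>1: "\<delta>1 > 0" "\<delta>1 \<le> \<delta>0" "\<delta>1 \<le> c / 2" using \<delta>0 c_pos by (auto simp: \<delta>1_def)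
  define \<delta> where "\<delta> = min e (\<delta>1 / (4 * (\<mu> + 1)))"
  have \<delta>: "\<delta> > 0" "\<delta> < 1" "\<delta> \<le> e" "\<delta> * \<mu> \<le> \<delta>1 / 4"
  proof -
    show "\<delta> > 0" "\<delta> < 1" "\<delta> \<le> e" using e \<delta>1 mean_nonneg by (auto simp: \<delta>_def)
    have "\<delta> * \<mu> \<le> \<delta>1 / (4 * (\<mu> + 1)) * (\<mu> + 1)"
      using mean_nonneg \<delta>1 by (intro mult_mono) (auto simp: \<delta>_def)
    also have "\<dots> = \<delta>1 / 4"
    proof -
      have "\<mu> + 1 \<noteq> 0" using mean_nonneg by linarith
      then show ?thesis by (simp add: divide_simps)
    qed
    finally show "\<delta> * \<mu> \<le> \<delta>1 / 4" .
  qed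
  \<comment> \<open>As k \<le> 2 * t, each entry and the fluctuation of the sum are at most
    \<delta>1 * t / 4, and replacing k by t in the mean costs \<delta>1 * t / 2. The sum plus any
    entry then exceeds \<mu> * t by at most \<delta>1 * t < c * t.\<close>
  define \<eta> where "\<eta> = \<delta>1 / 8"
  have \<eta>: "\<eta> > 0" using \<delta>1 by (simp add: \<eta>_def)
  define U where "U u t n = u ^ n * of_bool (\<delta> * t < \<bar>real n - t\<bar>)" for u t :: real and n
  obtain u where u: "u > 1" "\<And>t. t > 0 \<Longrightarrow> summable (\<lambda>n. pmf (poisson_pmf t) n * U u t n)"
      "((\<lambda>t. mixture t (U u t)) \<longlongrightarrow> 0) at_top"
    unfolding U_def mixture_def using poisson_tilted_tail[OF \<delta>(1,2)] by blast
  define bad where "bad k = {xs. \<eta> * real k < \<bar>real (sum_list xs) - \<mu> * real k\<bar> \<or>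
      (\<exists>x\<in>set xs. \<eta> * real k < real x)}" for k
  have "\<forall>\<^sub>F k in sequentially. measure_pmf.prob (replicate_pmf k p) (bad k) \<le> e"
    unfolding bad_def mean by (rule weak_law_replicate[OF integrable \<eta> e(1)])
  then obtain k0 where "\<forall>k\<ge>k0. measure_pmf.prob (replicate_pmf k p) (bad k) \<le> e"
    unfolding eventually_sequentially ..
  then have k0: "measure_pmf.prob (replicate_pmf k p) (bad k) \<le> e" if "k \<ge> k0" for k
    using that by blast
  from order_tendstoD(2)[OF u(3) e(1)]
  have T: "\<forall>\<^sub>F t in at_top. mixture t (U u t) < e" .
  have "\<forall>\<^sub>F t in at_top. 2 * real k0 + 4 \<le> t \<and> 4 * \<mu> / \<delta>1 \<le> t"
    by (intro eventually_conj eventually_ge_at_top)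
  with T \<delta>0(2) threshold_linear show ?thesis
  proof (eventually_elim, intro allI impI)
    fix t m A
    assume T: "mixture t (U u t) < e"
      and near: "\<forall>m k. (\<mu> + c) * t \<le> real m \<longrightarrow>
        \<bar>real k - (real m - \<mu> * t)\<bar> \<le> \<delta>0 * t + 1 \<longrightarrow> k \<ge> 1 \<and> \<bar>pmf p k / pmf p (excess t m) - 1\<bar> \<le> e"
      and lin: "(\<mu> + c) * t \<le> y t" and t: "2 * real k0 + 4 \<le> t \<and> 4 * \<mu> / \<delta>1 \<le> t" and m: "y t \<le> real m"
    have t0: "t > 0" using t by linarith
    have m': "(\<mu> + c) * t \<le> real m" using lin m by linarith
    note ex = excess_bounds[OF t0 m']
    define P where "P = pmf p (excess t m)"
    have P: "P > 0" using pmf_pos ex(4) by (simp add: P_def)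
    define w where "w n = measure_pmf.prob (replicate_pmf n p)" for n
    define b where "b n = w n {xs. bulk xs \<in> A \<and> sum_list xs = m}" for n
    have tP: "(1 - e) * (1 - e) * (t * P) \<ge> 0" using e t0 P by simp
    have central: "(1 - e) * (1 - e) * (t * P) * (w (n - 1) A - e) \<le> b n"
      if n: "\<bar>real n - t\<bar> \<le> \<delta> * t" for n
    proof -
      have dt: "\<delta> * t \<le> e * t" "e * t \<le> 1 / 2 * t"
        using \<delta>(3) e(2) t0 by (intro mult_right_mono; linarith)+
      then have nt: "(1 - e) * t \<le> real n" "t / 2 \<le> real n" "real n \<le> 2 * t"
        unfolding left_diff_distrib using n t0 dt by linarith+
      define k where "k = n - 1"
      have k: "n = Suc k" "real n = real k + 1" "k \<ge> k0"
        using nt(2) t by (auto simp: k_def of_nat_diff)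
      \<comment> \<open>The configurations to which \<open>prob_bulk_ge\<close> applies; the last
        condition also bounds all entries by m, which makes G finite.\<close>
      define G where "G = {a. length a = k \<and> \<bar>real (sum_list a) - \<mu> * t\<bar> \<le> \<delta>1 * t \<and>
          (\<forall>z\<in>set a. z + sum_list a < m)}"
      have "G \<subseteq> {a. set a \<subseteq> {..<m} \<and> length a = k}" by (force simp: G_def)
      then have finG: "finite (A \<inter> G)"
        by (rule finite_subset[OF order.trans[OF Int_lower2]]) (simp add: finite_lists_length_eq)
      have good: "a \<in> G" if a: "length a = k" "a \<notin> bad k" for a
      proof -
        have nb: "\<bar>real (sum_list a) - \<mu> * real k\<bar> \<le> \<eta> * real k" "\<And>z. z \<in> set a \<Longrightarrow> real z \<le> \<eta> * real k"
          using a by (auto simp: bad_def not_less)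
        have "\<eta> * real k \<le> \<eta> * (2 * t)" using nt k \<eta> by (intro mult_left_mono) auto
        then have ek: "\<eta> * real k \<le> \<delta>1 * t / 4" by (simp add: \<eta>_def)
        have "\<bar>\<mu> * real k - \<mu> * t\<bar> = \<mu> * \<bar>real k - t\<bar>"
          using mean_nonneg by (simp add: abs_mult flip: right_diff_distrib)
        also have "\<dots> \<le> \<mu> * (\<delta> * t + 1)"
          using n k mean_nonneg by (intro mult_left_mono) auto
        also have "\<dots> = (\<delta> * \<mu>) * t + \<mu>" by (simp add: algebra_simps)
        also have "\<dots> \<le> (\<delta>1 / 4) * t + (\<delta>1 / 4) * t"
          using t \<delta>1 t0 by (intro add_mono mult_right_mono \<delta>) (auto simp: field_simps)
        finally have mk: "\<bar>\<mu> * real k - \<mu> * t\<bar> \<le> \<delta>1 * t / 2" by simp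
        have s: "\<bar>real (sum_list a) - \<mu> * t\<bar> \<le> 3 / 4 * (\<delta>1 * t)" using nb(1) ek mk by linarith
        have d1: "\<delta>1 * t \<le> c * t / 2" "\<delta>1 * t > 0" "c * t > 0"
          using mult_right_mono[OF \<delta>1(3), of t] t0 \<delta>1 c_pos by auto
        have "z + sum_list a < m" if "z \<in> set a" for z
        proof -
          have "real z + real (sum_list a) \<le> \<mu> * t + \<delta>1 * t" using nb(2)[OF that] ek s by linarith
          also have "\<dots> < (\<mu> + c) * t" using d1 by (simp add: algebra_simps)
          finally show ?thesis using m' by linarith
        qed
        with a s d1 show ?thesis by (auto simp: G_def)
      qed
      have "w k A \<le> w k (A \<inter> G \<union> bad k)"
        unfolding w_def
      proof (rule measure_pmf.finite_measure_mono_AE)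
        have "x \<in> A \<longrightarrow> x \<in> A \<inter> G \<union> bad k" if "x \<in> set_pmf (replicate_pmf k p)" for x
        proof -
          have "length x = k" using that by (subst (asm) set_replicate_pmf) auto
          then show ?thesis using good by auto
        qed
        then show "AE x in replicate_pmf k p. x \<in> A \<longrightarrow> x \<in> A \<inter> G \<union> bad k"
          by (simp add: AE_measure_pmf_iff)
      qed auto
      also have "\<dots> \<le> w k (A \<inter> G) + w k (bad k)"
        unfolding w_def by (rule measure_Un_le) auto
      also have "w k (bad k) \<le> e" unfolding w_def by (rule k0[OF k(3)])
      finally have wA: "w k A - e \<le> w k (A \<inter> G)" by simp
      have "(1 - e) * (1 - e) * (t * P) * (w k A - e) \<le> (1 - e) * (1 - e) * (t * P) * w k (A \<inter> G)"
        by (rule mult_left_mono[OF wA tP])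
      also have "\<dots> = ((1 - e) * t) * ((1 - e) * P * w k (A \<inter> G))" by simp
      \<comment> \<open>The n insertion positions supply the factor t.\<close>
      also have "\<dots> \<le> real n * ((1 - e) * P * w k (A \<inter> G))"
        using e P by (intro mult_right_mono nt) (auto simp: w_def)
      also have "(1 - e) * P * w k (A \<inter> G) = (\<Sum>a\<in>A \<inter> G. pmf (replicate_pmf k p) a * ((1 - e) * P))"
        unfolding w_def measure_measure_pmf_finite[OF finG] by (simp add: sum_distrib_left mult_ac)
      also have "real n * \<dots> \<le> real n * (\<Sum>a\<in>A \<inter> G. pmf (replicate_pmf k p) a * pmf p (m - sum_list a))"
      proof (intro mult_left_mono sum_mono)
        fix a assume "a \<in> A \<inter> G"
        then have a: "\<bar>real (sum_list a) - \<mu> * t\<bar> \<le> \<delta>1 * t" by (auto simp: G_def)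
        have d1: "\<delta>1 * t \<le> \<delta>0 * t" "\<delta>1 * t \<le> c * t / 2" "c * t > 0"
          using mult_right_mono[OF \<delta>1(2), of t] mult_right_mono[OF \<delta>1(3), of t] t0 c_pos by auto
        have "real (sum_list a) \<le> real m" using a d1 m' by (simp add: algebra_simps abs_le_iff)
        then have "\<bar>real (m - sum_list a) - (real m - \<mu> * t)\<bar> \<le> \<delta>0 * t + 1"
          using a d1 by (simp add: of_nat_diff abs_le_iff)
        with near m' have "\<bar>pmf p (m - sum_list a) / P - 1\<bar> \<le> e" unfolding P_def by blast
        then show "(1 - e) * P \<le> pmf p (m - sum_list a)" using near_one_divide_iff[OF P] by blast
      qed auto
      also have "\<dots> \<le> w n {xs. bulk xs \<in> A \<inter> G \<and> sum_list xs = m}"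
        unfolding w_def k(1) by (rule prob_bulk_ge[OF finG]) (auto simp: G_def)
      also have "\<dots> \<le> b n"
        unfolding b_def w_def by (rule measure_pmf.finite_measure_mono) auto
      finally show ?thesis by (simp add: k_def)
    qed
    have low: "(1 - e) * (1 - e) * (t * P) * (w (n - 1) A - e - U u t n) \<le> b n" for n
    proof (cases "\<delta> * t < \<bar>real n - t\<bar>")
      case False
      then show ?thesis using central[of n] by (simp add: U_def)
    next
      case True
      then have "U u t n \<ge> 1" using u(1) by (simp add: U_def)
      moreover have "w (n - 1) A \<le> 1" by (simp add: w_def)
      ultimately have "(1 - e) * (1 - e) * (t * P) * (w (n - 1) A - e - U u t n) \<le> 0"
        using tP e by (intro mult_nonneg_nonpos) auto
      also have "0 \<le> b n" by (simp add: b_def w_def)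
      finally show ?thesis .
    qed
    let ?q = "pmf (poisson_pmf t)"
    have sA: "(\<lambda>n. ?q n * w (n - 1) A) sums free_prob t A"
      unfolding free_prob_def mixture_def w_def by (rule summable_sums[OF summable_mixture_prob])
    have sb: "(\<lambda>n. ?q n * b n) sums bulk_prob t m A"
      unfolding bulk_prob_def mixture_def w_def b_def by (rule summable_sums[OF summable_mixture_prob])
    have sU: "(\<lambda>n. ?q n * U u t n) sums mixture t (U u t)"
      unfolding mixture_def by (rule summable_sums[OF u(2)[OF t0]])
    have "(\<lambda>n. ?q n * ((1 - e) * (1 - e) * (t * P) * (w (n - 1) A - e - U u t n))) sums
        ((1 - e) * (1 - e) * (t * P) * (free_prob t A - 1 * e - mixture t (U u t)))"
      using sums_mult[OF sums_diff[OF sums_diff[OF sA sums_mult2[OF pmf_nat_sums[of "poisson_pmf t"], of e]] sU],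
          of "(1 - e) * (1 - e) * (t * P)"]
      by (simp add: algebra_simps)
    from sums_le[OF mult_left_mono[OF low pmf_nonneg] this sb]
    have main: "(1 - e) * (1 - e) * (t * P) * (free_prob t A - e - mixture t (U u t)) \<le> bulk_prob t m A"
      by simp
    show "(free_prob t A - \<epsilon>) * (1 - \<epsilon>) * (t * pmf p (excess t m)) \<le> bulk_prob t m A"
    \<comment> \<open>Replacing 1 - \<epsilon> by the larger (1 - e)^2 increases the left side only
      if its first factor is nonnegative; otherwise the left side is at most 0 already.\<close>
    proof (cases "free_prob t A \<le> \<epsilon>")
      case True
      then have "(free_prob t A - \<epsilon>) * (1 - \<epsilon>) * (t * P) \<le> 0"
        using assms t0 P by (intro mult_nonpos_nonneg) auto
      also have "0 \<le> bulk_prob t m A" unfolding bulk_prob_def by (rule mixture_prob_nonneg)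
      finally show ?thesis by (simp add: P_def)
    next
      case False
      have "1 - \<epsilon> \<le> (1 - e) * (1 - e)" by (simp add: e_def algebra_simps)
      then have "(free_prob t A - \<epsilon>) * (1 - \<epsilon>) * (t * P) \<le> (free_prob t A - \<epsilon>) * ((1 - e) * (1 - e)) * (t * P)"
        using False t0 P by (intro mult_right_mono mult_left_mono) auto
      also have "\<dots> = (1 - e) * (1 - e) * (t * P) * (free_prob t A - \<epsilon>)" by simp
      also have "\<dots> \<le> (1 - e) * (1 - e) * (t * P) * (free_prob t A - e - mixture t (U u t))"
        using T by (intro mult_left_mono tP) (simp add: e_def)
      also note main
      finally show ?thesis by (simp add: P_def)
    qed
  qed
qed

text \<open>Up to null sets a configuration misses \<open>pos_seqs\<close> only for N \<le> 1, an
  event of probability exp (- t) * (1 + t).\<close>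

lemma free_prob_pos_seqs: "((\<lambda>t. free_prob t pos_seqs) \<longlongrightarrow> 1) at_top"
proof -
  have full: "measure_pmf.prob (replicate_pmf (n - 1) p) pos_seqs = 1 - of_bool (n \<le> 1)" for n
  proof (cases "n \<le> 1")
    case True
    then have "n - 1 = 0" by simp
    then show ?thesis using True by (simp add: pos_seqs_def measure_return_pmf indicator_def)
  next
    case False
    have "set_pmf (replicate_pmf (n - 1) p) \<subseteq> pos_seqs"
    proof
      fix xs assume "xs \<in> set_pmf (replicate_pmf (n - 1) p)"
      then have xs: "length xs = n - 1" "set xs \<subseteq> set_pmf p" by (auto simp: set_replicate_pmf)
      moreover have "0 \<notin> set_pmf p" using pmf_0 by (simp add: set_pmf_iff)
      ultimately have "set xs \<subseteq> {1..}" "xs \<noteq> []" using False by (auto simp: Suc_le_eq intro!: gr0I)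
      then show "xs \<in> pos_seqs" by (simp add: pos_seqs_def)
    qed
    then have "measure_pmf.prob (replicate_pmf (n - 1) p) pos_seqs = 1"
      by (subst measure_pmf.prob_eq_1) (auto simp: AE_measure_pmf_iff)
    then show ?thesis using False by simp
  qed
  have "free_prob t pos_seqs = 1 - (exp (- t) + t * exp (- t))" if "t > 0" for t
  proof -
    have "(\<lambda>n. pmf (poisson_pmf t) n * of_bool (n \<le> 1)) sums (\<Sum>n\<in>{0, 1}. pmf (poisson_pmf t) n * of_bool (n \<le> 1))"
      by (rule sums_finite) auto
    from sums_diff[OF pmf_nat_sums[of "poisson_pmf t"] this]
    have "(\<lambda>n. pmf (poisson_pmf t) n * (1 - of_bool (n \<le> 1))) sums (1 - (exp (- t) + t * exp (- t)))"
      using that by (simp add: right_diff_distrib)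
    then show ?thesis unfolding free_prob_def mixture_def full by (rule sums_unique[symmetric])
  qed
  note eq = this
  have "\<forall>\<^sub>F t in at_top. 1 - (exp (- t) + t * exp (- t)) = free_prob t pos_seqs"
    using eventually_gt_at_top[of 0] by eventually_elim (simp add: eq)
  moreover have "((\<lambda>t. 1 - (exp (- t) + t * exp (- t :: real))) \<longlongrightarrow> 1) at_top" by real_asymp
  ultimately show ?thesis by (rule Lim_transform_eventually[rotated])
qed

text \<open>The lower bound, applied to \<open>A\<close> and to its complement, already controls the total variation
  distance.\<close>

lemma bulk_prob_asymp:
  assumes "\<epsilon> > 0"
  shows "\<forall>\<^sub>F t in at_top. \<forall>m. y t \<le> real m \<longrightarrow> (\<forall>A\<subseteq>pos_seqs.
    \<bar>bulk_prob t m A / mixture t (\<lambda>n. conv n m) - free_prob t A\<bar> \<le> \<epsilon>)"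
proof -
  define e where "e = min \<epsilon> 1 / 4"
  have e: "e > 0" "e \<le> 1 / 4" "e \<le> 1" "4 * e \<le> \<epsilon>" using assms by (auto simp: e_def)
  have full: "\<forall>\<^sub>F t in at_top. 1 - e < free_prob t pos_seqs"
    using order_tendstoD(1)[OF free_prob_pos_seqs, of "1 - e"] e by simp
  from full bulk_prob_lower[OF e(1,3)] mixture_conv_asymp[OF e(1)] threshold_linear eventually_gt_at_top[of 0]
  show ?thesis
  proof (eventually_elim, intro allI impI)
    fix t m A
    assume full: "1 - e < free_prob t pos_seqs"
      and low: "\<forall>m A. y t \<le> real m \<longrightarrow>
        (free_prob t A - e) * (1 - e) * (t * pmf p (excess t m)) \<le> bulk_prob t m A"
      and Z: "\<forall>m. y t \<le> real m \<longrightarrow> \<bar>mixture t (\<lambda>n. conv n m) / (t * pmf p (excess t m)) - 1\<bar> \<le> e"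
      and lin: "(\<mu> + c) * t \<le> y t" and t0: "0 < t" and m: "y t \<le> real m" and A: "A \<subseteq> pos_seqs"
    have m': "(\<mu> + c) * t \<le> real m" using lin m by linarith
    define P where "P = t * pmf p (excess t m)"
    have P: "P > 0" using pmf_pos excess_bounds(4)[OF t0 m'] t0 by (simp add: P_def)
    define Z' where "Z' = mixture t (\<lambda>n. conv n m)"
    have Z': "(1 - e) * P \<le> Z'" "Z' \<le> (1 + e) * P"
      using Z m near_one_divide_iff[OF P] unfolding P_def Z'_def by blast+
    moreover have "(1 - e) * P > 0" using e P by simp
    ultimately have Z0: "Z' > 0" by linarith
    \<comment> \<open>One e is lost in \<open>bulk_prob_lower\<close>, and 2 * e through (1 - e) /
      (1 + e) \<ge> 1 - 2 * e.\<close>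
    have lower: "free_prob t D - 3 * e \<le> bulk_prob t m D / Z'" for D
    proof (cases "free_prob t D \<le> e")
      case True
      then have "free_prob t D - 3 * e \<le> 0" using e by simp
      also have "0 \<le> bulk_prob t m D / Z'" unfolding bulk_prob_def by (intro divide_nonneg_pos mixture_prob_nonneg Z0)
      finally show ?thesis .
    next
      case False
      have f1: "free_prob t D \<le> 1" unfolding free_prob_def by (rule mixture_prob_le_1)
      have "(free_prob t D - e) * (1 - 2 * e) * Z' \<le> (free_prob t D - e) * (1 - 2 * e) * ((1 + e) * P)"
        using False e Z' by (intro mult_left_mono) auto
      also have "\<dots> = (free_prob t D - e) * P * ((1 - 2 * e) * (1 + e))" by simp
      also have "\<dots> \<le> (free_prob t D - e) * P * (1 - e)"
        using False P e by (intro mult_left_mono) (auto simp: algebra_simps)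
      also have "\<dots> \<le> bulk_prob t m D" using low m by (simp add: P_def mult_ac)
      finally have "(free_prob t D - e) * (1 - 2 * e) \<le> bulk_prob t m D / Z'"
        using Z0 by (simp add: pos_le_divide_eq)
      moreover have "free_prob t D - 3 * e \<le> (free_prob t D - e) * (1 - 2 * e)"
      proof -
        have "2 * e * free_prob t D \<le> 2 * e * 1" using f1 e by (intro mult_left_mono) auto
        moreover have "(free_prob t D - e) * (1 - 2 * e) = free_prob t D - e - 2 * e * free_prob t D + 2 * (e * e)"
          by (simp add: algebra_simps)
        moreover have "e * e \<ge> 0" using e by simp
        ultimately show ?thesis by linarith
      qed
      ultimately show ?thesis by linarith
    qed
    let ?q = "pmf (poisson_pmf t)"
    have sf: "(\<lambda>n. ?q n * measure_pmf.prob (replicate_pmf (n - 1) p) D) sums free_prob t D" for D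
      unfolding free_prob_def mixture_def by (rule summable_sums[OF summable_mixture_prob])
    have sb: "(\<lambda>n. ?q n * measure_pmf.prob (replicate_pmf n p) {xs. bulk xs \<in> D \<and> sum_list xs = m}) sums bulk_prob t m D" for D
      unfolding bulk_prob_def mixture_def by (rule summable_sums[OF summable_mixture_prob])
    have conv: "conv n m = measure_pmf.prob (replicate_pmf n p) {xs. sum_list xs = m}" for n
      by (simp add: conv_def pmf_map vimage_def)
    have sZ: "(\<lambda>n. ?q n * measure_pmf.prob (replicate_pmf n p) {xs. sum_list xs = m}) sums Z'"
      unfolding Z'_def mixture_def conv by (rule summable_sums[OF summable_mixture_prob])
    \<comment> \<open>Only an inequality: sequences with at most one entry have an empty bulk, which
      lies outside \<open>pos_seqs\<close>.\<close>
    have "bulk_prob t m A + bulk_prob t m (pos_seqs - A) \<le> Z'"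
    proof (rule sums_le[OF _ sums_add[OF sb sb] sZ])
      fix n
      let ?w = "measure_pmf.prob (replicate_pmf n p)"
      have "?w {xs. bulk xs \<in> A \<and> sum_list xs = m} + ?w {xs. bulk xs \<in> pos_seqs - A \<and> sum_list xs = m} =
          ?w ({xs. bulk xs \<in> A \<and> sum_list xs = m} \<union> {xs. bulk xs \<in> pos_seqs - A \<and> sum_list xs = m})"
        by (rule measure_pmf.finite_measure_Union[symmetric]) auto
      also have "\<dots> \<le> ?w {xs. sum_list xs = m}"
        by (rule measure_pmf.finite_measure_mono) auto
      finally show "?q n * ?w {xs. bulk xs \<in> A \<and> sum_list xs = m} +
          ?q n * ?w {xs. bulk xs \<in> pos_seqs - A \<and> sum_list xs = m} \<le> ?q n * ?w {xs. sum_list xs = m}"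
        by (simp add: mult_left_mono flip: distrib_left)
    qed
    then have "bulk_prob t m A / Z' + bulk_prob t m (pos_seqs - A) / Z' \<le> 1"
      using Z0 by (simp add: pos_divide_le_eq flip: add_divide_distrib)
    moreover have "free_prob t pos_seqs = free_prob t A + free_prob t (pos_seqs - A)"
    proof (rule sums_unique2[OF sf])
      have "measure_pmf.prob (replicate_pmf (n - 1) p) pos_seqs =
          measure_pmf.prob (replicate_pmf (n - 1) p) A + measure_pmf.prob (replicate_pmf (n - 1) p) (pos_seqs - A)" for n
        using A by (subst measure_pmf.finite_measure_Union[symmetric]) (auto simp: Un_absorb1)
      then show "(\<lambda>n. ?q n * measure_pmf.prob (replicate_pmf (n - 1) p) pos_seqs) sums
          (free_prob t A + free_prob t (pos_seqs - A))"
        using sums_add[OF sf[of A] sf[of "pos_seqs - A"]] by (simp add: distrib_left)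
    qed
    \<comment> \<open>The upper bound for A comes from the lower one for the complement, with loss 3
      * e, and from the free mass missing in \<open>pos_seqs\<close>, at most e.\<close>
    ultimately have "\<bar>bulk_prob t m A / Z' - free_prob t A\<bar> \<le> 4 * e"
      using lower[of A] lower[of "pos_seqs - A"] full e by (simp add: abs_le_iff)
    then show "\<bar>bulk_prob t m A / mixture t (\<lambda>n. conv n m) - free_prob t A\<bar> \<le> \<epsilon>"
      using e by (simp add: Z'_def)
  qed
qed

end


section \<open>Transfer to random variables\<close>

lemma pmf_expectation_sums:
  fixes p :: "nat pmf"
  assumes f: "\<And>n. f n \<ge> 0" and s: "(\<lambda>n. pmf p n * f n) sums s"
  shows "integrable p f" "measure_pmf.expectation p f = s"
proof -
  have s0: "s \<ge> 0" using f by (intro sums_le[OF _ sums_zero s]) auto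
  have "(\<integral>\<^sup>+n. ennreal (f n) \<partial>p) = (\<Sum>n. ennreal (pmf p n * f n))"
    using f by (simp add: nn_integral_measure_pmf nn_integral_count_space_nat ennreal_mult)
  also have "\<dots> = ennreal s"
    by (rule suminf_ennreal_eq[OF _ s]) (use f in auto)
  finally have "has_bochner_integral p f s"
    using f s0 by (intro has_bochner_integral_nn_integral) auto
  then show "integrable p f" "measure_pmf.expectation p f = s"
    by (auto simp: has_bochner_integral_iff)
qed

lemma sum_list_segment: "sum_list (segment Xs n w) = (\<Sum>i=1..n. Xs i w)"
  by (induction n) (simp_all add: segment_def)

lemma length_segment [simp]: "length (segment Xs n w) = n"
  by (simp add: segment_def del: upt_Suc)

lemma segment_eq_iff: "segment Xs n w = a \<longleftrightarrow> length a = n \<and> (\<forall>i\<in>{1..n}. Xs i w = a ! (i - 1))"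
proof
  assume "length a = n \<and> (\<forall>i\<in>{1..n}. Xs i w = a ! (i - 1))"
  then show "segment Xs n w = a"
    by (intro nth_equalityI) (auto simp: segment_def nth_append nth_upt simp del: upt_Suc)
qed (auto simp: segment_def nth_upt simp del: upt_Suc)

lemma measurable_segment:
  assumes "\<And>i. i \<ge> 1 \<Longrightarrow> Xs i \<in> measurable M (count_space UNIV)"
  shows "segment Xs n \<in> measurable M (count_space UNIV)"
proof (subst measurable_count_space_eq2_countable, intro conjI ballI)
  fix a :: "nat list"
  have "segment Xs n -` {a} \<inter> space M =
      (if length a = n then {w \<in> space M. \<forall>i\<in>{1..n}. Xs i w = a ! (i - 1)} else {})"
    by (auto simp: segment_eq_iff)
  also have "\<dots> \<in> sets M"
    using assms by (auto intro!: sets.sets_Collect_finite_All' measurable_sets_Collect[where M=M and N="count_space UNIV"])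
  finally show "segment Xs n -` {a} \<inter> space M \<in> sets M" .
qed auto

context prob_space
begin

lemma distr_eq_pmf:
  fixes X :: "'a \<Rightarrow> nat"
  assumes X: "X \<in> measurable M (count_space UNIV)"
  obtains p where "distr M (count_space UNIV) X = measure_pmf p"
proof -
  define f where "f k = prob (X -` {k} \<inter> space M)" for k
  have "f sums prob (\<Union>k. X -` {k} \<inter> space M)"
    unfolding f_def
    by (rule finite_measure_UNION) (use X in \<open>auto simp: disjoint_family_on_def intro: measurable_sets\<close>)
  moreover have "(\<Union>k. X -` {k} \<inter> space M) = space M" by auto
  ultimately have f: "f sums 1" by (simp add: prob_space)
  have "(\<integral>\<^sup>+k. ennreal (f k) \<partial>count_space UNIV) = 1"
  proof -
    have "(\<Sum>k. ennreal (f k)) = ennreal 1"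
      by (rule suminf_ennreal_eq[OF _ f]) (simp add: f_def)
    then show ?thesis by (simp add: nn_integral_count_space_nat)
  qed
  then have p: "pmf (embed_pmf f) k = f k" for k
    by (intro pmf_embed_pmf) (simp_all add: f_def)
  have "distr M (count_space UNIV) X = measure_pmf (embed_pmf f)"
    by (rule measure_eqI_countable[where A = UNIV])
      (use X p in \<open>auto simp: emeasure_distr emeasure_pmf_single f_def emeasure_eq_measure\<close>)
  then show ?thesis by (rule that)
qed

lemma distr_segment:
  assumes indep: "indep_vars (\<lambda>_. count_space UNIV) Xs {1..}"
    and p: "\<And>i. i \<ge> 1 \<Longrightarrow> distr M (count_space UNIV) (Xs i) = measure_pmf p"
  shows "distr M (count_space UNIV) (segment Xs n) = measure_pmf (replicate_pmf n p)"
proof -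
  have rv: "Xs i \<in> measurable M (count_space UNIV)" if "i \<ge> 1" for i
    using indep that by (auto simp: indep_vars_def)
  have single: "prob (Xs i -` {k} \<inter> space M) = pmf p k" if "i \<ge> 1" for i k
    using measure_distr[OF rv[OF that], of "{k}"] by (simp add: p[OF that] pmf.rep_eq)
  have "prob (segment Xs n -` {a} \<inter> space M) = pmf (replicate_pmf n p) a" for a
  proof (cases "length a = n")
    case False
    then have "segment Xs n -` {a} \<inter> space M = {}" by (auto simp: segment_eq_iff)
    with False show ?thesis by (simp add: pmf_replicate)
  next
    case True
    show ?thesis
    \<comment> \<open>An empty intersection is \<open>UNIV\<close> rather than the sample space, and
      \<open>indep_varsD\<close> asks for a nonempty index set.\<close>
    proof (cases "n = 0")
      case True
      then show ?thesis using \<open>length a = n\<close>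
        by (simp add: segment_def vimage_def prob_space indicator_def)
    next
      case False
      have "segment Xs n -` {a} \<inter> space M = (\<Inter>i\<in>{1..n}. Xs i -` {a ! (i - 1)} \<inter> space M)"
        using True False by (auto simp: segment_eq_iff)
      also have "prob \<dots> = (\<Prod>i\<in>{1..n}. prob (Xs i -` {a ! (i - 1)} \<inter> space M))"
        by (rule indep_varsD[OF indep]) (use False in auto)
      also have "\<dots> = (\<Prod>i\<in>{1..n}. pmf p (a ! (i - 1)))"
        by (intro prod.cong) (auto simp: single)
      also have "\<dots> = (\<Prod>i<n. pmf p (a ! i))"
        by (rule prod.reindex_bij_witness[of _ Suc "\<lambda>i. i - 1"]) auto
      also have "\<dots> = prod_list (map (pmf p) a)"
        using True by (simp add: prod.list_conv_set_nth atLeast0LessThan)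
      finally show ?thesis using True by (simp add: pmf_replicate)
    qed
  qed
  then show ?thesis
    by (intro measure_eqI_countable[where A = UNIV])
      (auto simp: emeasure_distr measurable_segment rv emeasure_pmf_single emeasure_eq_measure)
qed

text \<open>Decomposition over the values of N. The function h is the identity for the sum and the
  bulk, and n - 1 for the free configuration.\<close>

lemma prob_random_segment:
  assumes indep: "indep_vars (\<lambda>_. count_space UNIV) Xs {1..}"
    and p: "\<And>i. i \<ge> 1 \<Longrightarrow> distr M (count_space UNIV) (Xs i) = measure_pmf p"
    and N: "indep_poisson M Xs t N"
    and rv': "\<And>i. i \<ge> 1 \<Longrightarrow> Xs i \<in> measurable M (count_space {1..})"
  shows "\<P>(w in M. segment Xs (h (N w)) w \<in> B) =
    (\<Sum>n. pmf (poisson_pmf t) n * measure_pmf.prob (replicate_pmf (h n) p) B)"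
proof -
  have rv: "Xs i \<in> measurable M (count_space UNIV)" if "i \<ge> 1" for i
    using indep that by (auto simp: indep_vars_def)
  have Nm: "N \<in> measurable M (count_space UNIV)"
    and Nd: "distr M (count_space UNIV) N = measure_pmf (poisson_pmf t)"
    and ind: "indep_set (sets (vimage_algebra (space M) N (count_space UNIV)))
       (sets (vimage_algebra (space M) (\<lambda>w. \<lambda>i\<in>{1..}. Xs i w) (PiM {1..} (\<lambda>_. count_space {1..}))))"
    using N by (auto simp: indep_poisson_def)
  have seg_meas: "segment Xs (h n) \<in> measurable M (count_space UNIV)" for n
    by (intro measurable_segment rv)
  define E where "E n = {w \<in> space M. N w = n \<and> segment Xs (h n) w \<in> B}" for n
  have E: "prob (E n) = pmf (poisson_pmf t) n * measure_pmf.prob (replicate_pmf (h n) p) B" for n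
  proof -
    let ?P = "PiM {1..} (\<lambda>_. count_space {1..}) :: (nat \<Rightarrow> nat) measure"
    let ?S = "segment (\<lambda>i f. f i) (h n) -` B \<inter> space ?P"
    have "(\<lambda>f. f i) \<in> measurable ?P (count_space UNIV)" if "i \<ge> 1" for i
    proof (rule measurable_compose[where N = "count_space {1..}"])
      show "(\<lambda>f. f i) \<in> measurable ?P (count_space {1..})"
        by (rule measurable_component_singleton) (use that in simp)
    qed (rule measurable_count_space)
    then have S: "?S \<in> sets ?P"
      by (intro measurable_sets[OF measurable_segment]) auto
    \<comment> \<open>Independence concerns the whole sequence restricted to indices from 1 on.
      \<open>segment\<close> reads no other index, so its events lie in that sigma-algebra.\<close>
    have seg: "(\<lambda>w. \<lambda>i\<in>{1..}. Xs i w) -` ?S \<inter> space M = segment Xs (h n) -` B \<inter> space M"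
    proof -
      have "(\<lambda>i\<in>{1..}. Xs i w) \<in> space ?P" if "w \<in> space M" for w
        using measurable_space[OF rv' that] by (auto simp: space_PiM)
      moreover have "segment (\<lambda>i f. f i) (h n) (\<lambda>i\<in>{1..}. Xs i w) = segment Xs (h n) w" for w
        by (auto simp: segment_def)
      ultimately show ?thesis by auto
    qed
    have "E n = (N -` {n} \<inter> space M) \<inter> (segment Xs (h n) -` B \<inter> space M)"
      by (auto simp: E_def)
    also have "prob \<dots> = prob (N -` {n} \<inter> space M) * prob (segment Xs (h n) -` B \<inter> space M)"
    proof (rule indep_setD[OF ind])
      show "N -` {n} \<inter> space M \<in> sets (vimage_algebra (space M) N (count_space UNIV))"
        by (rule in_vimage_algebra) simp
      show "segment Xs (h n) -` B \<inter> space M \<in> sets (vimage_algebra (space M) (\<lambda>w. \<lambda>i\<in>{1..}. Xs i w) ?P)"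
        unfolding seg[symmetric] by (rule in_vimage_algebra[OF S])
    qed
    also have "prob (N -` {n} \<inter> space M) = pmf (poisson_pmf t) n"
      using measure_distr[OF Nm, of "{n}"] by (simp add: Nd pmf.rep_eq del: pmf_poisson)
    also have "prob (segment Xs (h n) -` B \<inter> space M) = measure_pmf.prob (replicate_pmf (h n) p) B"
      using measure_distr[OF seg_meas, of B n] distr_segment[OF indep p, of "h n"]
      by simp
    finally show ?thesis .
  qed
  have meas: "E n \<in> sets M" for n
  proof -
    have "E n = (N -` {n} \<inter> space M) \<inter> (segment Xs (h n) -` B \<inter> space M)"
      by (auto simp: E_def)
    then show ?thesis
      using measurable_sets[OF Nm, of "{n}"] measurable_sets[OF seg_meas, of B n] by auto
  qed
  have "(\<lambda>n. prob (E n)) sums prob (\<Union>n. E n)"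
    by (rule finite_measure_UNION) (use meas in \<open>auto simp: disjoint_family_on_def E_def\<close>)
  moreover have "(\<Union>n. E n) = {w \<in> space M. segment Xs (h (N w)) w \<in> B}"
    by (auto simp: E_def)
  ultimately show ?thesis unfolding E by (simp add: sums_unique)
qed

end

section \<open>The hypotheses in the form used by the analysis\<close>

lemma irv_of_intermediate_regular_variation:
  assumes M: "prob_space M" and p: "\<And>k. \<P>(w in M. X w = k) = pmf p k"
    and law: "positive_law p" and irv: "intermediate_regular_variation M X"
  shows "positive_law.irv p"
  unfolding positive_law.irv_def[OF law]
proof (intro allI impI)
  fix \<epsilon> :: real assume \<epsilon>: "\<epsilon> > 0"
  define R where "R \<eta> m = {k::nat. 1 \<le> k \<and> \<bar>real k / real m - 1\<bar> < \<eta>}" for \<eta> and m :: nat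
  have inf: "((\<lambda>\<eta>. liminf (\<lambda>m. INF k\<in>R \<eta> m. ereal (pmf p k / pmf p m))) \<longlongrightarrow> 1) (at_right 0)"
    and sup: "((\<lambda>\<eta>. limsup (\<lambda>m. SUP k\<in>R \<eta> m. ereal (pmf p k / pmf p m))) \<longlongrightarrow> 1) (at_right 0)"
    using irv unfolding intermediate_regular_variation_def p R_def by auto
  have "ereal (1 - \<epsilon>) < 1" "1 < ereal (1 + \<epsilon>)" using \<epsilon> by (auto simp: one_ereal_def)
  note this = order_tendstoD(1)[OF inf this(1)] order_tendstoD(2)[OF sup this(2)]
  \<comment> \<open>Both limits run along the same filter at 0, so a single \<eta> serves the lower
    and the upper side; the last conjunct makes it positive.\<close>
  from eventually_conj[OF eventually_conj[OF this] eventually_at_right_less[of 0]]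
  obtain \<eta> where \<eta>: "\<eta> > 0"
      "ereal (1 - \<epsilon>) < liminf (\<lambda>m. INF k\<in>R \<eta> m. ereal (pmf p k / pmf p m))"
      "limsup (\<lambda>m. SUP k\<in>R \<eta> m. ereal (pmf p k / pmf p m)) < ereal (1 + \<epsilon>)"
    using eventually_happens[of _ "at_right (0::real)"] trivial_limit_at_right_real by blast
  have "\<forall>\<^sub>F m in sequentially. \<forall>k\<ge>1. \<bar>real k / real m - 1\<bar> < \<eta> \<longrightarrow> \<bar>pmf p k / pmf p m - 1\<bar> \<le> \<epsilon>"
    using less_LiminfD[OF \<eta>(2)] Limsup_lessD[OF \<eta>(3)]
  proof (eventually_elim, intro allI impI)
    fix m k :: nat
    assume lo: "ereal (1 - \<epsilon>) < (INF k\<in>R \<eta> m. ereal (pmf p k / pmf p m))"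
      and hi: "(SUP k\<in>R \<eta> m. ereal (pmf p k / pmf p m)) < ereal (1 + \<epsilon>)"
      and k: "1 \<le> k" "\<bar>real k / real m - 1\<bar> < \<eta>"
    have "k \<in> R \<eta> m" using k by (simp add: R_def)
    then have "ereal (1 - \<epsilon>) < ereal (pmf p k / pmf p m)" "ereal (pmf p k / pmf p m) < ereal (1 + \<epsilon>)"
      using order.strict_trans2[OF lo INF_lower] order.strict_trans1[OF SUP_upper hi] by auto
    then show "\<bar>pmf p k / pmf p m - 1\<bar> \<le> \<epsilon>" by auto
  qed
  with \<eta>(1) show "\<exists>\<eta>>0. \<forall>\<^sub>F m in sequentially. \<forall>k\<ge>1. \<bar>real k / real m - 1\<bar> < \<eta> \<longrightarrow>
      \<bar>pmf p k / pmf p m - 1\<bar> \<le> \<epsilon>" by blast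
qed

text \<open>For finite \<xi> the gap between \<gamma> and \<mu> + \<xi> pays for all n up to (1 + d)
  * t. For infinite \<xi> the two factors 1 + \<omega> have separate tasks: the inner one and
  monotonicity give x n \<le> x ((1 + \<omega>) * t), and the outer one leaves \<omega> * x ((1 +
  \<omega>) * t), which covers n * \<mu> because x is superlinear.\<close>

lemma jump_threshold_conditions:
  fixes x :: "real \<Rightarrow> real" and \<mu> \<gamma> \<omega> :: real
  assumes pos: "\<And>t. t > 0 \<Longrightarrow> x t > 0" and mono: "mono_on {T..} x" and \<mu>: "\<mu> \<ge> 0"
    and sup: "scale_limsup x = \<infinity> \<Longrightarrow> (\<lambda>n. ereal (x (real n) / real n)) \<longlonglongrightarrow> \<infinity>"
    and \<gamma>: "scale_limsup x < \<infinity> \<Longrightarrow> ereal \<mu> + scale_limsup x < ereal \<gamma>" and \<omega>: "\<omega> > 0"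
  obtains c d where "c > 0" "d > 0"
    "\<forall>\<^sub>F t in at_top. (\<mu> + c) * t \<le> jump_threshold x \<gamma> \<omega> t"
    "\<forall>\<^sub>F t in at_top. \<forall>n::nat. \<bar>real n - t\<bar> \<le> d * t \<longrightarrow> real n * \<mu> + x (real n) \<le> jump_threshold x \<gamma> \<omega> t"
proof (cases "scale_limsup x < \<infinity>")
  case True
  have "0 \<le> scale_limsup x"
    unfolding scale_limsup_def
  proof (rule le_Limsup)
    have "0 \<le> x (real n) / real n" for n
      using pos[of "real n"] by (cases "n = 0") auto
    then show "\<forall>\<^sub>F n in sequentially. 0 \<le> ereal (x (real n) / real n)"
      by simp
  qed simp
  with True obtain r where r: "scale_limsup x = ereal r" "r \<ge> 0"
    by (cases "scale_limsup x") auto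
  have \<gamma>': "\<mu> + r < \<gamma>" using \<gamma>[OF True] r by simp
  \<comment> \<open>Half of the gap goes into the estimate x n \<le> (r + \<eta>) * n, the other
    half, through s * d \<le> \<eta>, into the width of the window.\<close>
  define \<eta> where "\<eta> = (\<gamma> - \<mu> - r) / 2"
  have \<eta>: "\<eta> > 0" using \<gamma>' by (simp add: \<eta>_def)
  define s where "s = \<gamma> - \<eta>"
  have s: "s \<ge> 0" "s = \<mu> + (r + \<eta>)" using \<gamma>' r \<mu> by (auto simp: s_def \<eta>_def field_simps)
  define d where "d = min (1 / 2) (\<eta> / (s + 1))"
  have d: "d > 0" "d \<le> 1 / 2" "s * d \<le> \<eta>"
  proof -
    show "d > 0" unfolding d_def using \<eta> s(1) by simp
    show "d \<le> 1 / 2" unfolding d_def by (rule min.cobounded1)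
    have "d \<le> \<eta> / (s + 1)" unfolding d_def by (rule min.cobounded2)
    then have "s * d \<le> (s + 1) * (\<eta> / (s + 1))" using s(1) \<open>d > 0\<close> by (intro mult_mono) auto
    also have "\<dots> = \<eta>" using s(1) by simp
    finally show "s * d \<le> \<eta>" .
  qed
  have "limsup (\<lambda>n. ereal (x (real n) / real n)) < ereal (r + \<eta>)"
    using r \<eta> by (simp add: scale_limsup_def)
  from Limsup_lessD[OF this] obtain n0 where n0: "\<And>n. n \<ge> n0 \<Longrightarrow> x (real n) / real n < r + \<eta>"
    by (auto simp: eventually_sequentially)
  have y: "jump_threshold x \<gamma> \<omega> t = \<gamma> * t" for t using True by (simp add: jump_threshold_def)
  show ?thesis
  proof (rule that[of "\<gamma> - \<mu>" d])
    have "\<forall>\<^sub>F t in at_top. 2 * real n0 \<le> t \<and> (0::real) < t"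
      by (intro eventually_conj eventually_ge_at_top eventually_gt_at_top)
    then show "\<forall>\<^sub>F t in at_top. \<forall>n::nat. \<bar>real n - t\<bar> \<le> d * t \<longrightarrow> real n * \<mu> + x (real n) \<le> jump_threshold x \<gamma> \<omega> t"
    proof (eventually_elim, intro allI impI)
      fix t n assume t: "2 * real n0 \<le> t \<and> 0 < t" and n: "\<bar>real n - t\<bar> \<le> d * t"
      have "d * t \<le> 1 / 2 * t" using d t by (intro mult_right_mono) auto
      then have nn: "real n \<ge> real n0" "real n > 0" using n t by linarith+
      have "x (real n) \<le> (r + \<eta>) * real n" using n0[of n] nn by (simp add: pos_divide_less_eq)
      then have "real n * \<mu> + x (real n) \<le> s * real n" unfolding s(2) by (simp add: algebra_simps)
      also have "\<dots> \<le> s * ((1 + d) * t)" using n s(1) by (intro mult_left_mono) (auto simp: algebra_simps abs_le_iff)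
      also have "\<dots> = (s + s * d) * t" by (simp add: algebra_simps)
      also have "\<dots> \<le> \<gamma> * t" using d(3) t by (intro mult_right_mono) (auto simp: s_def)
      finally show "real n * \<mu> + x (real n) \<le> jump_threshold x \<gamma> \<omega> t" by (simp add: y)
    qed
  qed (use \<gamma>' r d in \<open>auto simp: y\<close>)
next
  case False
  then have "scale_limsup x = \<infinity>" by simp
  note lim = sup[OF this]
  have y: "jump_threshold x \<gamma> \<omega> t = (1 + \<omega>) * x ((1 + \<omega>) * t)" for t
    using False by (simp add: jump_threshold_def)
  \<comment> \<open>The limit runs over integers; monotonicity carries the bound from the integer
    part n of (1 + \<omega>) * t to the real argument. Using 2 * K makes up for knowing only n \<ge>
    t / 2.\<close>
  have super: "\<forall>\<^sub>F t in at_top. K * t \<le> x ((1 + \<omega>) * t)" if "K \<ge> 0" for K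
  proof -
    have "\<forall>\<^sub>F n in sequentially. ereal (2 * K) < ereal (x (real n) / real n)"
      using lim by (simp add: tendsto_PInfty)
    then obtain n0 where n0: "\<And>n. n \<ge> n0 \<Longrightarrow> 2 * K < x (real n) / real n"
      by (auto simp: eventually_sequentially)
    have "\<forall>\<^sub>F t in at_top. real n0 + 1 \<le> t \<and> T + 1 \<le> t \<and> 2 \<le> t"
      by (intro eventually_conj eventually_ge_at_top)
    then show ?thesis
    proof eventually_elim
      fix t assume t: "real n0 + 1 \<le> t \<and> T + 1 \<le> t \<and> 2 \<le> t"
      define n where "n = nat \<lfloor>(1 + \<omega>) * t\<rfloor>"
      have wt: "(1 + \<omega>) * t \<ge> t" using \<omega> t by (simp add: algebra_simps)
      then have n: "real n \<le> (1 + \<omega>) * t" "(1 + \<omega>) * t < real n + 1"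
        unfolding n_def using t by linarith+
      have n': "n \<ge> n0" "real n \<ge> T" "real n > 0" "t / 2 \<le> real n" using n wt t by linarith+
      have "K * t \<le> 2 * K * real n"
        using mult_left_mono[OF n'(4), of "2 * K"] that by simp
      also have "\<dots> \<le> x (real n)" using n0[OF n'(1)] n'(3) by (simp add: pos_less_divide_eq)
      also have "\<dots> \<le> x ((1 + \<omega>) * t)" using n n' by (intro mono_onD[OF mono]) auto
      finally show "K * t \<le> x ((1 + \<omega>) * t)" .
    qed
  qed
  define d where "d = min \<omega> (1 / 2)"
  have d: "d > 0" "d \<le> \<omega>" "d \<le> 1 / 2" using \<omega> by (auto simp: d_def)
  show ?thesis
  proof (rule that[of 1 d])
    have "\<mu> + 1 \<ge> 0" using \<mu> by simp
    from super[OF this] eventually_gt_at_top[of 0]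
    show "\<forall>\<^sub>F t in at_top. (\<mu> + 1) * t \<le> jump_threshold x \<gamma> \<omega> t"
    proof eventually_elim
      fix t :: real assume t: "(\<mu> + 1) * t \<le> x ((1 + \<omega>) * t)" "t > 0"
      have "0 \<le> \<omega> * x ((1 + \<omega>) * t)" using \<omega> t pos by (intro mult_nonneg_nonneg less_imp_le[OF pos]) auto
      then show "(\<mu> + 1) * t \<le> jump_threshold x \<gamma> \<omega> t" using t(1) by (simp add: y algebra_simps)
    qed
    \<comment> \<open>The slope for which \<omega> * x ((1 + \<omega>) * t) \<ge> 2 * t * \<mu>, and
      n \<le> 2 * t in the window.\<close>
    have "2 * \<mu> / \<omega> \<ge> 0" using \<mu> \<omega> by simp
    moreover have "\<forall>\<^sub>F t in at_top. 2 * T \<le> t \<and> (0::real) < t"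
      by (intro eventually_conj eventually_ge_at_top eventually_gt_at_top)
    ultimately show "\<forall>\<^sub>F t in at_top. \<forall>n::nat. \<bar>real n - t\<bar> \<le> d * t \<longrightarrow> real n * \<mu> + x (real n) \<le> jump_threshold x \<gamma> \<omega> t"
      using super
    proof (elim eventually_elim2[OF super, rotated], intro allI impI)
      fix t n assume t: "2 * T \<le> t \<and> 0 < t" and K: "2 * \<mu> / \<omega> * t \<le> x ((1 + \<omega>) * t)"
        and n: "\<bar>real n - t\<bar> \<le> d * t"
      have dt: "d * t \<le> 1 / 2 * t" "d * t \<le> \<omega> * t" using d t by (intro mult_right_mono; linarith)+
      have n1: "real n \<le> 2 * t" "T \<le> real n" "real n \<le> (1 + \<omega>) * t"
        unfolding distrib_right using n dt t by linarith+
      have "x (real n) \<le> x ((1 + \<omega>) * t)" using n1 by (intro mono_onD[OF mono]) auto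
      moreover have "real n * \<mu> \<le> \<omega> * x ((1 + \<omega>) * t)"
      proof -
        have "real n * \<mu> \<le> 2 * t * \<mu>" using n1 \<mu> by (intro mult_right_mono)
        also have "\<dots> = \<omega> * (2 * \<mu> / \<omega> * t)" using \<omega> by simp
        also have "\<dots> \<le> \<omega> * x ((1 + \<omega>) * t)" using K \<omega> by (intro mult_left_mono) auto
        finally show ?thesis .
      qed
      ultimately show "real n * \<mu> + x (real n) \<le> jump_threshold x \<gamma> \<omega> t"
        by (simp add: y algebra_simps)
    qed
  qed (use d in auto)
qed

text \<open>In \<open>ereal\<close> the supremum over the empty set is - \<infinity>, hence the
  nonemptiness hypothesis; with it, nonnegative terms give the lower half of the limit.\<close>

lemma tendsto_SUP_0:
  fixes f :: "'a \<Rightarrow> 'b \<Rightarrow> ereal"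
  assumes small: "\<And>\<epsilon>. \<epsilon> > 0 \<Longrightarrow> \<forall>\<^sub>F v in F. \<forall>m\<in>S v. f v m \<le> ereal \<epsilon>"
    and nonneg: "\<And>v m. 0 \<le> f v m" and nonempty: "\<And>v. S v \<noteq> {}"
  shows "((\<lambda>v. SUP m\<in>S v. f v m) \<longlongrightarrow> 0) F"
proof (rule order_tendstoI)
  fix a :: ereal assume "a < 0"
  have "0 \<le> (SUP m\<in>S v. f v m)" for v
  proof -
    obtain m where "m \<in> S v" using nonempty by blast
    then show ?thesis using nonneg by (intro SUP_upper2)
  qed
  with \<open>a < 0\<close> show "\<forall>\<^sub>F v in F. a < (SUP m\<in>S v. f v m)"
    by (intro always_eventually allI) (rule order.strict_trans2)
next
  fix a :: ereal assume "0 < a"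
  then obtain \<epsilon> where \<epsilon>: "0 < ereal \<epsilon>" "ereal \<epsilon> < a" using ereal_dense2 by blast
  then have "\<epsilon> > 0" by simp
  from small[OF this] show "\<forall>\<^sub>F v in F. (SUP m\<in>S v. f v m) < a"
  proof eventually_elim
    case (elim v)
    then have "(SUP m\<in>S v. f v m) \<le> ereal \<epsilon>" by (intro SUP_least) auto
    then show ?case using \<epsilon>(2) by (rule order.strict_trans1)
  qed
qed

theorem proposition3:
  fixes M :: "'a measure"
    and Q :: "nat \<Rightarrow> real"
    and X :: "'a \<Rightarrow> nat"
    and Xs :: "nat \<Rightarrow> 'a \<Rightarrow> nat"
    and N :: "real \<Rightarrow> 'a \<Rightarrow> nat"
    and x :: "real \<Rightarrow> real"
    and \<gamma> \<omega> :: real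
  defines "q \<equiv> crit_q Q" and "\<rho> \<equiv> crit_rho Q"
  assumes M: "prob_space M"
    and Q: "weight_seq Q" "crit_summable Q"
    and X: "crit_law M Q X"
    and Xs: "iid_copies M X Xs"
    and N: "\<And>t. t > 0 \<Longrightarrow> indep_poisson M Xs t (N t)"
    and I: "subexp_density M X Xs"
    and II: "one_big_jump M X Xs x"
    and III: "intermediate_regular_variation M X"
    and x_superlinear:
      "scale_limsup x = \<infinity> \<Longrightarrow> (\<lambda>n. ereal (x (real n) / real n)) \<longlonglongrightarrow> \<infinity>"
    and \<gamma>: "scale_limsup x < \<infinity> \<Longrightarrow> ereal (\<rho> / q) + scale_limsup x < ereal \<gamma>"
    and \<omega>: "\<omega> > 0"
  shows "((\<lambda>V::real. SUP m\<in>{m::int. jump_threshold x \<gamma> \<omega> (q * V) \<le> real_of_int m}.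
            ereal \<bar>\<P>(w in M. int (\<Sum>i=1..N (q * V) w. Xs i w) = m) /
                    (q * V * \<P>(w in M. int (X w) = \<lceil>real_of_int m - \<rho> * V\<rceil>)) - 1\<bar>)
          \<longlongrightarrow> 0) at_top \<and>
         ((\<lambda>V::real. SUP m\<in>{m::int. jump_threshold x \<gamma> \<omega> (q * V) \<le> real_of_int m}.
            SUP A\<in>Pow pos_seqs.
            ereal \<bar>\<P>(w in M. bulk (segment Xs (N (q * V) w) w) \<in> A
                      \<bar> int (\<Sum>i=1..N (q * V) w. Xs i w) = m)
                    - \<P>(w in M. segment Xs (N (q * V) w - 1) w \<in> A)\<bar>)
          \<longlongrightarrow> 0) at_top"
proof -
  interpret prob_space M by (rule M)
  have widen: "f \<in> measurable M (count_space UNIV)" if "f \<in> measurable M (count_space {1..})" for f :: "'a \<Rightarrow> nat"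
    using that by (rule measurable_compose[where N = "count_space {1..}", OF _ measurable_count_space])
  have X': "X \<in> measurable M (count_space {1..})" using X by (simp add: crit_law_def)
  note Xm = widen[OF X']
  obtain p where p: "distr M (count_space UNIV) X = measure_pmf p" using distr_eq_pmf[OF Xm] by blast
  have pX: "\<P>(w in M. X w = k) = pmf p k" for k
  proof -
    have "X -` {k} \<inter> space M = {w \<in> space M. X w = k}" by auto
    then show ?thesis using measure_distr[OF Xm, of "{k}"] by (simp add: p pmf.rep_eq)
  qed
  have indep': "indep_vars (\<lambda>_. count_space {1..}) Xs {1..}"
    and same: "\<And>i. i \<ge> 1 \<Longrightarrow> distr M (count_space {1..}) (Xs i) = distr M (count_space {1..}) X"
    using Xs by (auto simp: iid_copies_def)
  have Xsm: "Xs i \<in> measurable M (count_space {1..})" if "i \<ge> 1" for i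
    using indep' that by (auto simp: indep_vars_def)
  have indep: "indep_vars (\<lambda>_. count_space UNIV) Xs {1..}"
    using indep_vars_compose2[OF indep', of "\<lambda>_ x. x" "\<lambda>_. count_space UNIV"] measurable_count_space by blast
  have pXs: "distr M (count_space UNIV) (Xs i) = measure_pmf p" if "i \<ge> 1" for i
  proof -
    have "distr M (count_space UNIV) f = distr (distr M (count_space {1..}) f) (count_space UNIV) (\<lambda>x. x)"
      if "f \<in> measurable M (count_space {1..})" for f :: "'a \<Rightarrow> nat"
      by (subst distr_distr[OF measurable_count_space that]) (simp add: comp_def)
    from this[OF Xsm[OF that]] this[OF X'] same[OF that] p show ?thesis by simp
  qed

  define \<phi> where "\<phi> = crit_fugacity Q"
  obtain L where L: "L > 0" "(\<lambda>r. Q r powr (1 / real r)) \<longlonglongrightarrow> L"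
    using Q(1) by (auto simp: weight_seq_def)
  have \<phi>: "\<phi> > 0" using L limI[OF L(2)] by (simp add: \<phi>_def crit_fugacity_def)
  have Qpos: "Q r > 0" if "r \<ge> 1" for r using Q(1) that by (simp add: weight_seq_def)
  have sm: "summable (\<lambda>r. Q (Suc r) * \<phi> ^ Suc r)" "summable (\<lambda>r. real (Suc r) * Q (Suc r) * \<phi> ^ Suc r)"
    using Q(2) unfolding crit_summable_def \<phi>_def by blast+
  have q: "q > 0"
    unfolding q_def crit_q_def \<phi>_def[symmetric]
    by (rule suminf_pos[OF sm(1)]) (use Qpos \<phi> in auto)
  have pk: "pmf p k = Q k * \<phi> ^ k / q" if "k \<ge> 1" for k
    using X that unfolding crit_law_def pX \<phi>_def q_def by blast
  interpret positive_law p
  proof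
    have "{w \<in> space M. X w = 0} = {}" using measurable_space[OF X'] by fastforce
    then show "pmf p 0 = 0" unfolding pX[of 0, symmetric] by (simp only: measure_empty)
    show "0 < pmf p k" if "k \<ge> 1" for k using pk[OF that] Qpos[OF that] \<phi> q by simp
  qed
  define \<mu> where "\<mu> = \<rho> / q"
  have "(\<lambda>r. real (Suc r) * Q (Suc r) * \<phi> ^ Suc r / q) sums \<mu>"
    unfolding \<mu>_def \<rho>_def crit_rho_def \<phi>_def[symmetric] by (intro sums_divide summable_sums sm)
  then have "(\<lambda>r. pmf p (Suc r) * real (Suc r)) sums \<mu>"
    by (simp add: pk mult_ac)
  then have "(\<lambda>r. pmf p r * real r) sums \<mu>"
    using sums_Suc[of "\<lambda>r. pmf p r * real r" \<mu>] by simp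
  note mean = pmf_expectation_sums[OF _ this, simplified]
  have \<mu>: "\<mu> \<ge> 0" using mean(2)[symmetric] by simp
  have EX: "(\<integral>w. real (X w) \<partial>M) = \<mu>"
    using integral_distr[OF Xm, of real] by (simp add: p mean(2))

  have conv_prob: "conv n m = measure_pmf.prob (replicate_pmf n p) {xs. sum_list xs = m}" for n m
    by (simp add: conv_def pmf_map vimage_def)
  have conv: "\<P>(w in M. (\<Sum>i=1..n. Xs i w) = m) = conv n m" for n m
  proof -
    have seg_meas: "segment Xs n \<in> measurable M (count_space UNIV)"
      by (intro measurable_segment widen Xsm)
    have "{w \<in> space M. (\<Sum>i=1..n. Xs i w) = m} = segment Xs n -` {xs. sum_list xs = m} \<inter> space M"
      by (auto simp: sum_list_segment)
    then show ?thesis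
      using measure_distr[OF seg_meas, of "{xs. sum_list xs = m}"]
        distr_segment[OF indep pXs, of n] by (simp add: conv_prob)
  qed

  have subexp: "(\<lambda>m. conv 2 m / (2 * pmf p m)) \<longlonglongrightarrow> 1"
  proof -
    have "\<P>(w in M. Xs 1 w + Xs 2 w = m) = conv 2 m" for m
      using conv[of 2 m] by (simp add: numeral_2_eq_2)
    then show ?thesis using I by (simp add: subexp_density_def pX)
  qed
  have irv: irv
    by (rule irv_of_intermediate_regular_variation[OF M pX positive_law_axioms III])
  obtain T where x: "\<And>t. t > 0 \<Longrightarrow> x t > 0" "mono_on {T..} x"
    using II by (auto simp: one_big_jump_def)
  have jump: "\<forall>\<^sub>F n in sequentially. \<forall>m::nat. real n * \<mu> + x (real n) \<le> real m \<longrightarrow>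
        \<bar>conv n m / (real n * pmf p (nat \<lceil>real m - real n * \<mu>\<rceil>)) - 1\<bar> \<le> \<epsilon>" if "\<epsilon> > 0" for \<epsilon>
  proof -
    have "(\<lambda>n. SUP m\<in>{m::int. real n * \<mu> + x (real n) \<le> real_of_int m}.
          ereal \<bar>\<P>(w in M. int (\<Sum>i=1..n. Xs i w) = m) /
                  (real n * \<P>(w in M. int (X w) = \<lceil>real_of_int m - real n * \<mu>\<rceil>)) - 1\<bar>) \<longlonglongrightarrow> 0"
      using II unfolding one_big_jump_def EX Let_def by blast
    moreover have "(0::ereal) < ereal \<epsilon>" using that by simp
    ultimately have "\<forall>\<^sub>F n in sequentially. (SUP m\<in>{m::int. real n * \<mu> + x (real n) \<le> real_of_int m}.
          ereal \<bar>\<P>(w in M. int (\<Sum>i=1..n. Xs i w) = m) /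
                  (real n * \<P>(w in M. int (X w) = \<lceil>real_of_int m - real n * \<mu>\<rceil>)) - 1\<bar>) < ereal \<epsilon>"
      by (rule order_tendstoD(2))
    with eventually_gt_at_top[of 0] show ?thesis
    proof (eventually_elim, intro allI impI)
      fix n m :: nat
      assume n: "0 < n" and sup: "(SUP m\<in>{m::int. real n * \<mu> + x (real n) \<le> real_of_int m}.
          ereal \<bar>\<P>(w in M. int (\<Sum>i=1..n. Xs i w) = m) /
                  (real n * \<P>(w in M. int (X w) = \<lceil>real_of_int m - real n * \<mu>\<rceil>)) - 1\<bar>) < ereal \<epsilon>"
        and m: "real n * \<mu> + x (real n) \<le> real m"
      have "int m \<in> {m::int. real n * \<mu> + x (real n) \<le> real_of_int m}" using m by simp
      from order.strict_trans1[OF SUP_upper[OF this] sup]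
      have "\<bar>\<P>(w in M. int (\<Sum>i=1..n. Xs i w) = int m) /
          (real n * \<P>(w in M. int (X w) = \<lceil>real_of_int (int m) - real n * \<mu>\<rceil>)) - 1\<bar> < \<epsilon>"
        by (simp only: less_ereal.simps)
      moreover have "x (real n) > 0" using x(1) n by simp
      \<comment> \<open>Positivity makes the integer ceiling agree with its \<open>nat\<close>, so
        (II) for integers yields the statement for naturals.\<close>
      then have "real m - real n * \<mu> > 0" using m by linarith
      then have "int k = \<lceil>real_of_int (int m) - real n * \<mu>\<rceil> \<longleftrightarrow> k = nat \<lceil>real m - real n * \<mu>\<rceil>" for k
        by auto
      ultimately show "\<bar>conv n m / (real n * pmf p (nat \<lceil>real m - real n * \<mu>\<rceil>)) - 1\<bar> \<le> \<epsilon>"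
        by (simp only: conv pX of_nat_eq_iff)
    qed
  qed
  obtain c d where cd: "c > 0" "d > 0"
    "\<forall>\<^sub>F t in at_top. (\<mu> + c) * t \<le> jump_threshold x \<gamma> \<omega> t"
    "\<forall>\<^sub>F t in at_top. \<forall>n::nat. \<bar>real n - t\<bar> \<le> d * t \<longrightarrow> real n * \<mu> + x (real n) \<le> jump_threshold x \<gamma> \<omega> t"
    using jump_threshold_conditions[OF x \<mu> x_superlinear \<gamma>[folded \<mu>_def] \<omega>] by blast
  interpret one_jump p \<mu> "\<lambda>n. x (real n)" "jump_threshold x \<gamma> \<omega>" c d
    by unfold_locales (use mean(1) mean(2)[symmetric] subexp irv jump cd in blast)+

  have seg: "\<P>(w in M. segment Xs (h (N t w)) w \<in> B) =
      mixture t (\<lambda>n. measure_pmf.prob (replicate_pmf (h n) p) B)" if "t > 0" for t h B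
    unfolding mixture_def by (rule prob_random_segment[OF indep pXs N[OF that] Xsm])
  have sum_prob: "\<P>(w in M. int (\<Sum>i=1..N t w. Xs i w) = int m) = mixture t (\<lambda>n. conv n m)" if "t > 0" for t m
    using seg[OF that, of "\<lambda>n. n" "{xs. sum_list xs = m}"]
    by (simp add: sum_list_segment conv_prob del: of_nat_sum)
  have bulk_event: "\<P>(w in M. bulk (segment Xs (N t w) w) \<in> A \<and> int (\<Sum>i=1..N t w. Xs i w) = int m) =
      bulk_prob t m A" if "t > 0" for t m A
    using seg[OF that, of "\<lambda>n. n" "{xs. bulk xs \<in> A \<and> sum_list xs = m}"]
    by (simp add: sum_list_segment bulk_prob_def del: of_nat_sum)
  have free_event: "\<P>(w in M. segment Xs (N t w - 1) w \<in> A) = free_prob t A" if "t > 0" for t A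
    using seg[OF that, of "\<lambda>n. n - 1" A] by (simp add: free_prob_def)
  have X_prob: "\<P>(w in M. int (X w) = \<lceil>real_of_int (int m) - \<rho> * V\<rceil>) = pmf p (excess (q * V) m)"
    if "V > 0" "(\<mu> + c) * (q * V) \<le> real m" for m V
  proof -
    have \<rho>: "\<mu> * (q * V) = \<rho> * V" using q by (simp add: \<mu>_def)
    have "c * (q * V) > 0" using cd(1) q that by simp
    then have "real m - \<rho> * V > 0" using that(2) \<rho> by (simp add: distrib_right)
    then have "int k = \<lceil>real_of_int (int m) - \<rho> * V\<rceil> \<longleftrightarrow> k = excess (q * V) m" for k
      unfolding excess_def \<rho> by auto
    then show ?thesis by (simp only: pX)
  qed
  have scale: "filterlim (\<lambda>V. q * V) at_top at_top" using q by real_asymp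
  have nonempty: "{m::int. jump_threshold x \<gamma> \<omega> (q * V) \<le> real_of_int m} \<noteq> {}" for V
    using le_of_int_ceiling[of "jump_threshold x \<gamma> \<omega> (q * V)"] by blast
  \<comment> \<open>Above the threshold m is nonnegative, so estimates for natural m control the
    suprema over integers.\<close>
  have nat_m: "\<exists>k. m = int k \<and> jump_threshold x \<gamma> \<omega> (q * V) \<le> real k \<and> (\<mu> + c) * (q * V) \<le> real k"
    if "V > 0" "(\<mu> + c) * (q * V) \<le> jump_threshold x \<gamma> \<omega> (q * V)" "jump_threshold x \<gamma> \<omega> (q * V) \<le> real_of_int m"
    for V m
  proof -
    have "0 \<le> (\<mu> + c) * (q * V)" using that(1) q \<mu> cd(1) by simp
    then have "0 \<le> real_of_int m" using that by linarith
    then show ?thesis using that by (intro exI[of _ "nat m"]) auto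
  qed
  show ?thesis
  proof
    show "((\<lambda>V::real. SUP m\<in>{m::int. jump_threshold x \<gamma> \<omega> (q * V) \<le> real_of_int m}.
            ereal \<bar>\<P>(w in M. int (\<Sum>i=1..N (q * V) w. Xs i w) = m) /
                    (q * V * \<P>(w in M. int (X w) = \<lceil>real_of_int m - \<rho> * V\<rceil>)) - 1\<bar>)
          \<longlongrightarrow> 0) at_top"
    proof (rule tendsto_SUP_0[OF _ _ nonempty])
      fix \<epsilon> :: real assume "\<epsilon> > 0"
      from eventually_compose_filterlim[OF mixture_conv_asymp[OF this] scale]
        eventually_compose_filterlim[OF cd(3) scale] eventually_gt_at_top[of 0]
      show "\<forall>\<^sub>F V in at_top. \<forall>m\<in>{m::int. jump_threshold x \<gamma> \<omega> (q * V) \<le> real_of_int m}.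
          ereal \<bar>\<P>(w in M. int (\<Sum>i=1..N (q * V) w. Xs i w) = m) /
            (q * V * \<P>(w in M. int (X w) = \<lceil>real_of_int m - \<rho> * V\<rceil>)) - 1\<bar> \<le> ereal \<epsilon>"
      proof (eventually_elim, intro ballI, unfold mem_Collect_eq)
        fix V :: real and m :: int
        assume asymp: "\<forall>m. jump_threshold x \<gamma> \<omega> (q * V) \<le> real m \<longrightarrow>
            \<bar>mixture (q * V) (\<lambda>n. conv n m) / (q * V * pmf p (excess (q * V) m)) - 1\<bar> \<le> \<epsilon>"
          and lin: "(\<mu> + c) * (q * V) \<le> jump_threshold x \<gamma> \<omega> (q * V)" and V: "0 < V"
          and m: "jump_threshold x \<gamma> \<omega> (q * V) \<le> real_of_int m"
        obtain k where k: "m = int k" "jump_threshold x \<gamma> \<omega> (q * V) \<le> real k" "(\<mu> + c) * (q * V) \<le> real k"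
          using nat_m[OF V lin m] by blast
        have t: "q * V > 0" using q V by simp
        show "ereal \<bar>\<P>(w in M. int (\<Sum>i=1..N (q * V) w. Xs i w) = m) /
            (q * V * \<P>(w in M. int (X w) = \<lceil>real_of_int m - \<rho> * V\<rceil>)) - 1\<bar> \<le> ereal \<epsilon>"
          unfolding k(1) sum_prob[OF t] X_prob[OF V k(3)] ereal_less_eq using asymp k(2) by blast
      qed
    qed simp
    show "((\<lambda>V::real. SUP m\<in>{m::int. jump_threshold x \<gamma> \<omega> (q * V) \<le> real_of_int m}.
            SUP A\<in>Pow pos_seqs.
            ereal \<bar>\<P>(w in M. bulk (segment Xs (N (q * V) w) w) \<in> A
                      \<bar> int (\<Sum>i=1..N (q * V) w. Xs i w) = m)
                    - \<P>(w in M. segment Xs (N (q * V) w - 1) w \<in> A)\<bar>)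
          \<longlongrightarrow> 0) at_top"
    proof (rule tendsto_SUP_0[OF _ _ nonempty])
      fix V :: real and m :: int
      show "0 \<le> (SUP A\<in>Pow pos_seqs. ereal \<bar>\<P>(w in M. bulk (segment Xs (N (q * V) w) w) \<in> A
                      \<bar> int (\<Sum>i=1..N (q * V) w. Xs i w) = m)
                    - \<P>(w in M. segment Xs (N (q * V) w - 1) w \<in> A)\<bar>)"
        by (rule SUP_upper2[of "{}"]) auto
    next
      fix \<epsilon> :: real assume "\<epsilon> > 0"
      from eventually_compose_filterlim[OF bulk_prob_asymp[OF this] scale]
        eventually_compose_filterlim[OF cd(3) scale] eventually_gt_at_top[of 0]
      show "\<forall>\<^sub>F V in at_top. \<forall>m\<in>{m::int. jump_threshold x \<gamma> \<omega> (q * V) \<le> real_of_int m}.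
          (SUP A\<in>Pow pos_seqs. ereal \<bar>\<P>(w in M. bulk (segment Xs (N (q * V) w) w) \<in> A
                      \<bar> int (\<Sum>i=1..N (q * V) w. Xs i w) = m)
                    - \<P>(w in M. segment Xs (N (q * V) w - 1) w \<in> A)\<bar>) \<le> ereal \<epsilon>"
      proof (eventually_elim, intro ballI SUP_least, unfold mem_Collect_eq Pow_iff)
        fix V :: real and m :: int and A
        assume asymp: "\<forall>m. jump_threshold x \<gamma> \<omega> (q * V) \<le> real m \<longrightarrow> (\<forall>A\<subseteq>pos_seqs.
            \<bar>bulk_prob (q * V) m A / mixture (q * V) (\<lambda>n. conv n m) - free_prob (q * V) A\<bar> \<le> \<epsilon>)"
          and lin: "(\<mu> + c) * (q * V) \<le> jump_threshold x \<gamma> \<omega> (q * V)" and V: "0 < V"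
          and m: "jump_threshold x \<gamma> \<omega> (q * V) \<le> real_of_int m" and A: "A \<subseteq> pos_seqs"
        obtain k where k: "m = int k" "jump_threshold x \<gamma> \<omega> (q * V) \<le> real k"
          using nat_m[OF V lin m] by blast
        have t: "q * V > 0" using q V by simp
        \<comment> \<open>Unfolding the conditional probability gives the quotient of
          \<open>bulk_prob\<close> by the mixture of \<open>conv\<close>, exactly the one estimated
          in \<open>bulk_prob_asymp\<close>.\<close>
        show "ereal \<bar>\<P>(w in M. bulk (segment Xs (N (q * V) w) w) \<in> A
                      \<bar> int (\<Sum>i=1..N (q * V) w. Xs i w) = m)
                    - \<P>(w in M. segment Xs (N (q * V) w - 1) w \<in> A)\<bar> \<le> ereal \<epsilon>"
          unfolding k(1) cond_prob_def sum_prob[OF t] bulk_event[OF t] free_event[OF t] ereal_less_eq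
          using asymp k(2) A by blast
      qed
    qed
  qed
qed

end
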